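(* Let $\lambda>0$ and $\beta\in\mathbb{R}$ be constants. Each of the three schemes (S1), (S2), (S3) defined in the context is second order in space and time for its associated equation: (S1) for $\partial_t q+\lambda\partial_x q=\partial_x(\alpha\,\partial_x q)+\beta q$ with prescribed space- and time-dependent diffusion coefficient $\alpha(x,t)$; (S2) for the same equation with $\alpha$ constant; and (S3) for the linear advection-reaction equation $\partial_t q+\lambda\partial_x q=\beta q$ (that is, $\alpha=0$). Precisely, for each scheme, for every sufficiently smooth solution $q(x,t)$ of the associated equation (and sufficiently smooth $\alpha$), the local truncation error $\tau_j^n$ at $(x_j,t^n)$ satisfies $$\tau_j^n=\mathcal{O}(\Delta t^2)+\mathcal{O}(\Delta x^2)+\mathcal{O}(\Delta x\,\Delta t)\qquad\text{as }\Delta x,\Delta t\to 0 .$$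
   Context: Uniform mesh with space step $\Delta x>0$ and time step $\Delta t>0$: $x_{i+k}=x_i+k\Delta x$ (also for half-integer $k$), $t^{n+1}=t^n+\Delta t$. Write $c=\frac{\lambda\Delta t}{\Delta x}$, $r=\beta\Delta t$, $\alpha^n_{i+k}=\alpha(x_{i+k},t^n)$, $\partial_t\alpha_{i\pm\frac12}=\partial_t\alpha(x_{i\pm\frac12},t^n)$, and, for constant $\alpha$, $d=\frac{\alpha\Delta t}{\Delta x^2}$. Each scheme is an explicit formula $q_i^{n+1}=H(q^n_{i-2},q^n_{i-1},q^n_i,q^n_{i+1},q^n_{i+2})$ (with coefficients depending on $\alpha$, $\lambda$, $\beta$, $\Delta x$, $\Delta t$, and, for (S1), on $i,n$). **Scheme (S1)** (space- and time-dependent diffusion): \begin{align*} q_i^{n+1}=\;& q_i^n-c\Big\{\tfrac{2+r}{2}(q_i^n-q_{i-1}^n)+\tfrac{2-2c+r}{8}(q_{i+1}^n-q_i^n-q_{i-1}^n+q_{i-2}^n)\\ &\quad+\tfrac{\Delta t}{2\Delta x^2}\big[\alpha^n_{i+\frac12}(q^n_{i+1}-q^n_i)-2\alpha^n_{i-\frac12}(q^n_i-q^n_{i-1})+\alpha^n_{i-\frac32}(q^n_{i-1}-q^n_{i-2})\big]\Big\}\\ &+\tfrac{\Delta t}{\Delta x^2}\Big\{\big[\alpha^n_{i+\frac12}+\tfrac{\Delta t}{2}\partial_t\alpha_{i+\frac12}\big]\Big[\tfrac{2+r}{2}(q^n_{i+1}-q^n_i)-\tfrac c4(q^n_{i+2}-q^n_{i+1}-q^n_i+q^n_{i-1})\\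 &\quad+\tfrac{\Delta t}{2\Delta x^2}\big(\alpha^n_{i+\frac32}(q^n_{i+2}-q^n_{i+1})-2\alpha^n_{i+\frac12}(q^n_{i+1}-q^n_i)+\alpha^n_{i-\frac12}(q^n_i-q^n_{i-1})\big)\Big]\\ &\quad+\big[\alpha^n_{i-\frac12}+\tfrac{\Delta t}{2}\partial_t\alpha_{i-\frac12}\big]\Big[\tfrac{2+r}{2}(q^n_{i-1}-q^n_i)-\tfrac c4(q^n_i-q^n_{i-2}-q^n_{i+1}+q^n_{i-1})\\ &\quad+\tfrac{\Delta t}{2\Delta x^2}\big(2\alpha^n_{i-\frac12}(q^n_i-q^n_{i-1})-\alpha^n_{i-\frac32}(q^n_{i-1}-q^n_{i-2})-\alpha^n_{i+\frac12}(q^n_{i+1}-q^n_i)\big)\Big]\Big\}\\ &+r\Big[q_i^n-\tfrac c4(q^n_{i+1}-q^n_{i-1})+\tfrac{\Delta t}{2\Delta x^2}\big(\alpha^n_{i+\frac12}(q^n_{i+1}-q^n_i)-\alpha^n_{i-\frac12}(q^n_i-q^n_{i-1})\big)+\tfrac r2 q^n_i\Big]. \end{align*} **Scheme (S2)** (constant diffusion coefficient $\alpha$): \begin{align*} q_i^{n+1}=\;& q_i^n-c\Big\{\tfrac{2+r}{2}(q_i^n-q_{i-1}^n)+\tfrac{2-2c+r}{8}(q_{i+1}^n-q_{i-1}^n-q_i^n+q_{i-2}^n)+\tfrac d2\big[q^n_{i+1}-3q^n_i+3q^n_{i-1}-q^n_{i-2}\big]\Big\}\\ &+d\Big\{q^n_{i+1}-2q^n_i+q^n_{i-1}-\tfrac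 c4(q^n_{i+2}-2q^n_{i+1}+2q^n_{i-1}-q^n_{i-2})\\ &\quad+\tfrac d2\big[q^n_{i+2}-4q^n_{i+1}+6q^n_i-4q^n_{i-1}+q^n_{i-2}\big]+\tfrac r2(q^n_{i+1}-2q^n_i+q^n_{i-1})\Big\}\\ &+r\Big[q^n_i-\tfrac c4(q^n_{i+1}-q^n_{i-1})+\tfrac d2(q^n_{i+1}-2q^n_i+q^n_{i-1})+\tfrac r2q^n_i\Big]. \end{align*} **Scheme (S3)** (no diffusion): \begin{align*} q_i^{n+1}=\;& q_i^n-c\Big[\tfrac{2+r}{2}(q_i^n-q_{i-1}^n)+\tfrac{2-2c+r}{8}(q_{i+1}^n-q_i^n-q_{i-1}^n+q_{i-2}^n)\Big]\\ &+r\Big[q^n_i-\tfrac c4(q^n_{i+1}-q^n_{i-1})+\tfrac r2q^n_i\Big]. \end{align*} **Local truncation error.** For a smooth exact solution $q(x,t)$ of the associated equation, $$\tau_j^n=\frac1{\Delta t}\Big[q(x_j,t^{n+1})-H\big(q(x_{j-2},t^n),q(x_{j-1},t^n),q(x_j,t^n),q(x_{j+1},t^n),q(x_{j+2},t^n)\big)\Big],$$ i.e. the residual, divided by $\Delta t$, obtained by inserting point values of the exact solution in the scheme. The $\mathcal{O}$ estimates are for a fixed point $(x_j,t^n)=(x,t)$ in the domain of the solution as $\Delta x,\Delta t\to0$: there is a constant $C$, depending only on the solution, $\alpha$, $\lambda$, $\beta$ and the point, with $|\tau_j^n|\le C(\Delta t^2+\Delta x^2+\Delta x\Delta t)$ for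 all sufficiently small $\Delta x,\Delta t>0$. *)

theory Defs
  imports "HOL-Analysis.Analysis" "HOL-Library.Landau_Symbols"
begin

text \<open>
  Functions of space and time are curried, \<open>f x t\<close>. The partial derivatives are taken with
  \<^const>\<open>deriv\<close>, so they are meaningful only where \<open>f\<close> is partially differentiable.
\<close>

definition deriv_x :: "(real \<Rightarrow> real \<Rightarrow> real) \<Rightarrow> real \<Rightarrow> real \<Rightarrow> real" where
  "deriv_x f x t = deriv (\<lambda>y. f y t) x"

definition deriv_t :: "(real \<Rightarrow> real \<Rightarrow> real) \<Rightarrow> real \<Rightarrow> real \<Rightarrow> real" where
  "deriv_t f x t = deriv (\<lambda>s. f x s) t"

text \<open>
  \<open>C_k_on k U f\<close>: on the open set \<open>U\<close>, all partial derivatives of \<open>f\<close> of order at most \<open>k\<close>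
  (pure and mixed, in any order) exist and are continuous.
\<close>

fun C_k_on :: "nat \<Rightarrow> (real \<times> real) set \<Rightarrow> (real \<Rightarrow> real \<Rightarrow> real) \<Rightarrow> bool" where
  "C_k_on 0 U f \<longleftrightarrow> continuous_on U (\<lambda>(x, t). f x t)"
| "C_k_on (Suc k) U f \<longleftrightarrow>
     continuous_on U (\<lambda>(x, t). f x t) \<and>
     (\<forall>(x, t) \<in> U. (\<lambda>y. f y t) differentiable (at x) \<and> (\<lambda>s. f x s) differentiable (at t)) \<and>
     C_k_on k U (deriv_x f) \<and> C_k_on k U (deriv_t f)"

definition solves_adv_diff_reac ::
    "(real \<Rightarrow> real \<Rightarrow> real) \<Rightarrow> real \<Rightarrow> real \<Rightarrow> (real \<times> real) set \<Rightarrow> (real \<Rightarrow> real \<Rightarrow> real) \<Rightarrow> bool" where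
  "solves_adv_diff_reac \<alpha> lam \<beta> U q \<longleftrightarrow>
     (\<forall>(x, t) \<in> U. deriv_t q x t + lam * deriv_x q x t =
                   deriv_x (\<lambda>y s. \<alpha> y s * deriv_x q y s) x t + \<beta> * q x t)"

definition solves_adv_reac ::
    "real \<Rightarrow> real \<Rightarrow> (real \<times> real) set \<Rightarrow> (real \<Rightarrow> real \<Rightarrow> real) \<Rightarrow> bool" where
  "solves_adv_reac lam \<beta> U q \<longleftrightarrow>
     (\<forall>(x, t) \<in> U. deriv_t q x t + lam * deriv_x q x t = \<beta> * q x t)"

text \<open>
  In the schemes, \<open>qm2\<close>, \<open>qm1\<close>, \<open>q0\<close>, \<open>qp1\<close>, \<open>qp2\<close> are the values at time level \<open>n\<close> in the
  cells \<open>i - 2, \<dots>, i + 2\<close>, and \<open>(x, t)\<close> is the mesh point \<open>(x\<^sub>i, t\<^sup>n)\<close>, at which the coefficients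
  of the variable-diffusion scheme are anchored: \<open>A k\<close> is the diffusion coefficient at
  \<open>x\<^sub>i + k \<Delta>x\<close>, and \<open>B k\<close> its time derivative there.
\<close>

definition scheme1 ::
    "(real \<Rightarrow> real \<Rightarrow> real) \<Rightarrow> real \<Rightarrow> real \<Rightarrow> real \<Rightarrow> real \<Rightarrow> real \<Rightarrow> real \<Rightarrow>
     real \<Rightarrow> real \<Rightarrow> real \<Rightarrow> real \<Rightarrow> real \<Rightarrow> real" where
  "scheme1 \<alpha> lam \<beta> x t \<Delta>x \<Delta>t qm2 qm1 q0 qp1 qp2 =
    (let c = lam * \<Delta>t / \<Delta>x;
         r = \<beta> * \<Delta>t;
         A = (\<lambda>k. \<alpha> (x + k * \<Delta>x) t);
         B = (\<lambda>k. deriv_t \<alpha> (x + k * \<Delta>x) t)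
     in q0
        - c * ((2 + r) / 2 * (q0 - qm1)
               + (2 - 2 * c + r) / 8 * (qp1 - q0 - qm1 + qm2)
               + \<Delta>t / (2 * \<Delta>x^2) *
                   (A (1/2) * (qp1 - q0) - 2 * A (-1/2) * (q0 - qm1) + A (-3/2) * (qm1 - qm2)))
        + \<Delta>t / \<Delta>x^2 *
            ((A (1/2) + \<Delta>t / 2 * B (1/2)) *
               ((2 + r) / 2 * (qp1 - q0)
                - c / 4 * (qp2 - qp1 - q0 + qm1)
                + \<Delta>t / (2 * \<Delta>x^2) *
                    (A (3/2) * (qp2 - qp1) - 2 * A (1/2) * (qp1 - q0) + A (-1/2) * (q0 - qm1)))
             + (A (-1/2) + \<Delta>t / 2 * B (-1/2)) *
               ((2 + r) / 2 * (qm1 - q0)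
                - c / 4 * (q0 - qm2 - qp1 + qm1)
                + \<Delta>t / (2 * \<Delta>x^2) *
                    (2 * A (-1/2) * (q0 - qm1) - A (-3/2) * (qm1 - qm2) - A (1/2) * (qp1 - q0))))
        + r * (q0 - c / 4 * (qp1 - qm1)
               + \<Delta>t / (2 * \<Delta>x^2) * (A (1/2) * (qp1 - q0) - A (-1/2) * (q0 - qm1))
               + r / 2 * q0))"

definition scheme2 ::
    "real \<Rightarrow> real \<Rightarrow> real \<Rightarrow> real \<Rightarrow> real \<Rightarrow> real \<Rightarrow> real \<Rightarrow> real \<Rightarrow> real \<Rightarrow> real \<Rightarrow> real" where
  "scheme2 \<alpha> lam \<beta> \<Delta>x \<Delta>t qm2 qm1 q0 qp1 qp2 =
    (let c = lam * \<Delta>t / \<Delta>x;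
         r = \<beta> * \<Delta>t;
         d = \<alpha> * \<Delta>t / \<Delta>x^2
     in q0
        - c * ((2 + r) / 2 * (q0 - qm1)
               + (2 - 2 * c + r) / 8 * (qp1 - qm1 - q0 + qm2)
               + d / 2 * (qp1 - 3 * q0 + 3 * qm1 - qm2))
        + d * (qp1 - 2 * q0 + qm1
               - c / 4 * (qp2 - 2 * qp1 + 2 * qm1 - qm2)
               + d / 2 * (qp2 - 4 * qp1 + 6 * q0 - 4 * qm1 + qm2)
               + r / 2 * (qp1 - 2 * q0 + qm1))
        + r * (q0 - c / 4 * (qp1 - qm1)
               + d / 2 * (qp1 - 2 * q0 + qm1)
               + r / 2 * q0))"

definition scheme3 ::
    "real \<Rightarrow> real \<Rightarrow> real \<Rightarrow> real \<Rightarrow> real \<Rightarrow> real \<Rightarrow> real \<Rightarrow> real \<Rightarrow> real \<Rightarrow> real" where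
  "scheme3 lam \<beta> \<Delta>x \<Delta>t qm2 qm1 q0 qp1 qp2 =
    (let c = lam * \<Delta>t / \<Delta>x;
         r = \<beta> * \<Delta>t
     in q0
        - c * ((2 + r) / 2 * (q0 - qm1)
               + (2 - 2 * c + r) / 8 * (qp1 - q0 - qm1 + qm2))
        + r * (q0 - c / 4 * (qp1 - qm1) + r / 2 * q0))"

definition truncation_error ::
    "(real \<Rightarrow> real \<Rightarrow> real \<Rightarrow> real \<Rightarrow> real \<Rightarrow> real) \<Rightarrow> (real \<Rightarrow> real \<Rightarrow> real) \<Rightarrow>
     real \<Rightarrow> real \<Rightarrow> real \<Rightarrow> real \<Rightarrow> real" where
  "truncation_error H q x t \<Delta>x \<Delta>t =
     (q x (t + \<Delta>t)
      - H (q (x - 2 * \<Delta>x) t) (q (x - \<Delta>x) t) (q x t) (q (x + \<Delta>x) t) (q (x + 2 * \<Delta>x) t)) / \<Delta>t"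

text \<open>
  \<open>\<tau>\<close> is bounded by a constant multiple of \<open>\<Delta>t\<^sup>2 + \<Delta>x\<^sup>2 + \<Delta>x \<Delta>t\<close> for all sufficiently
  small \<open>\<Delta>x, \<Delta>t > 0\<close>. The product filter lets the two steps tend to \<open>0\<close> independently, with no
  relation between them.
\<close>

definition second_order :: "(real \<Rightarrow> real \<Rightarrow> real) \<Rightarrow> bool" where
  "second_order \<tau> \<longleftrightarrow>
     (\<lambda>(\<Delta>x, \<Delta>t). \<tau> \<Delta>x \<Delta>t)
       \<in> O[at_right 0 \<times>\<^sub>F at_right 0](\<lambda>(\<Delta>x, \<Delta>t). \<Delta>t^2 + \<Delta>x^2 + \<Delta>x * \<Delta>t)"

end

theory Submission
  imports Defs
begin

text \<open>
  Write \<open>h\<close> and \<open>k\<close> for the space and time steps. Taylor expansion in time gives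
  \<open>q(x, t + k) = q + k q\<^sub>t + (k\<^sup>2 / 2) q\<^sub>t\<^sub>t + O(k\<^sup>3)\<close>, and the equation turns \<open>q\<^sub>t\<close> and \<open>q\<^sub>t\<^sub>t\<close> into
  space derivatives: \<open>q\<^sub>t = - \<lambda> q\<^sub>x + (\<alpha> q\<^sub>x)\<^sub>x + \<beta> q\<close>, and \<open>q\<^sub>t\<^sub>t\<close> comes from differentiating this once more
  in \<open>t\<close> and exchanging mixed derivatives (\<open>evolution\<close>, \<open>evolution_twice\<close>). The scheme with variable
  diffusion has the same shape: inserting point values of \<open>q\<close> gives exactly
  \<open>q + k (rate1 + (k / 2) rate2 + (k\<^sup>2 / 4) rate3)\<close>, where the rates do not depend on \<open>k\<close> and are built
  from central differences and multiplications by \<open>\<alpha>\<close> or \<open>\<alpha>\<^sub>t\<close> (\<open>scheme1_expansion\<close>). As \<open>h\<close> tends to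
  \<open>0\<close>, central differences become \<open>\<partial>\<^sub>x\<close>, so \<open>rate1\<close> becomes \<open>q\<^sub>t\<close> and \<open>rate2\<close> becomes \<open>q\<^sub>t\<^sub>t\<close>. The truncation
  error is therefore
  \<open>(q\<^sub>t - rate1) + (k / 2) (q\<^sub>t\<^sub>t - rate2) - (k\<^sup>2 / 4) rate3 + O(k\<^sup>2)\<close>, and it is enough that these
  differences are \<open>O(h\<^sup>2)\<close> and \<open>O(h)\<close> and that \<open>rate3\<close> is bounded.

  The difficulty is that differences are nested up to four deep, and each of them divides by \<open>h\<close>: a
  pointwise \<open>O(h\<^sup>2)\<close> bound on the error of an inner difference would be lost. The errors are, however,
  themselves smooth in the space variable, and their space derivatives are again \<open>O(h\<^sup>2)\<close>. The predicate
  \<open>small\<close> records a bound on an \<open>h\<close>-dependent function together with its derivatives up to some order, on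
  a neighbourhood of \<open>x\<close>. By the mean value theorem a central difference then costs one derivative
  and no power of \<open>h\<close> (\<open>small_cdiff\<close>), so second-order approximation is stable under products and
  central differences (\<open>approx_mult\<close>, \<open>approx_cdiff\<close>).

  Two places of the scheme are not centred at \<open>x\<close>. In the advective part of \<open>rate1\<close> the upwind
  gradient sits at \<open>x - h / 2\<close>, and the reconstructed slope moves it back to \<open>x\<close> up to \<open>O(h\<^sup>2)\<close>
  (\<open>upwind_gradient_consistent\<close>). In \<open>rate2\<close> the offset remains and costs \<open>O(h)\<close>, which the factor \<open>k\<close>
  turns into the \<open>O(h k)\<close> term. The other two schemes are the cases of constant
  and of vanishing \<open>\<alpha>\<close>.
\<close>

section \<open>Calculus of functions of space and time\<close>

lemma C_k_on_continuous: "C_k_on k U f \<Longrightarrow> continuous_on U (\<lambda>(x, t). f x t)"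
  by (cases k) auto

lemma C_k_on_Suc_imp: "C_k_on (Suc k) U f \<Longrightarrow> C_k_on k U f"
proof (induction k arbitrary: f)
  case 0
  then show ?case by simp
next
  case (Suc k)
  have "C_k_on k U (deriv_x f)" "C_k_on k U (deriv_t f)"
    using Suc.prems by (auto intro!: Suc.IH)
  then show ?case using Suc.prems by simp
qed

lemma C_k_on_mono:
  assumes "C_k_on n U f" "k \<le> n"
  shows "C_k_on k U f"
  using assms(2,1) by (induction rule: dec_induct) (auto dest!: C_k_on_Suc_imp simp del: C_k_on.simps)

lemma C_k_on_deriv_x: "C_k_on (Suc k) U f \<Longrightarrow> C_k_on k U (deriv_x f)"
  and C_k_on_deriv_t: "C_k_on (Suc k) U f \<Longrightarrow> C_k_on k U (deriv_t f)"
  by simp_all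

lemma C_k_on_has_deriv_x:
  assumes "C_k_on (Suc k) U f" "(x, t) \<in> U"
  shows "((\<lambda>y. f y t) has_real_derivative deriv_x f x t) (at x)"
  using assms by (auto simp: deriv_x_def DERIV_deriv_iff_real_differentiable)

lemma C_k_on_has_deriv_t:
  assumes "C_k_on (Suc k) U f" "(x, t) \<in> U"
  shows "((\<lambda>s. f x s) has_real_derivative deriv_t f x t) (at t)"
  using assms by (auto simp: deriv_t_def DERIV_deriv_iff_real_differentiable)

lemma eventually_slice_x:
  fixes U :: "(real \<times> real) set"
  assumes "open U" "(x, t) \<in> U"
  shows "\<forall>\<^sub>F y in nhds x. (y, t) \<in> U"
proof -
  have "((\<lambda>y. (y, t)) \<longlongrightarrow> (x, t)) (nhds x)"
    by (intro tendsto_intros filterlim_ident)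
  then show ?thesis using topological_tendstoD assms by blast
qed

lemma eventually_slice_t:
  fixes U :: "(real \<times> real) set"
  assumes "open U" "(x, t) \<in> U"
  shows "\<forall>\<^sub>F s in nhds t. (x, s) \<in> U"
proof -
  have "((\<lambda>s. (x, s)) \<longlongrightarrow> (x, t)) (nhds t)"
    by (intro tendsto_intros filterlim_ident)
  then show ?thesis using topological_tendstoD assms by blast
qed

lemma has_deriv_x_cong:
  fixes f g :: "real \<Rightarrow> real \<Rightarrow> real"
  assumes "open U" "\<And>x t. (x, t) \<in> U \<Longrightarrow> f x t = g x t" "(x, t) \<in> U"
  shows "((\<lambda>y. f y t) has_real_derivative D) (at x) \<longleftrightarrow> ((\<lambda>y. g y t) has_real_derivative D) (at x)"
  by (rule DERIV_cong_ev[OF refl eventually_mono[OF eventually_slice_x[OF assms(1,3)]] refl]) (rule assms(2))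

lemma has_deriv_t_cong:
  fixes f g :: "real \<Rightarrow> real \<Rightarrow> real"
  assumes "open U" "\<And>x t. (x, t) \<in> U \<Longrightarrow> f x t = g x t" "(x, t) \<in> U"
  shows "((\<lambda>s. f x s) has_real_derivative D) (at t) \<longleftrightarrow> ((\<lambda>s. g x s) has_real_derivative D) (at t)"
  by (rule DERIV_cong_ev[OF refl eventually_mono[OF eventually_slice_t[OF assms(1,3)]] refl]) (rule assms(2))

lemma deriv_x_cong:
  fixes f g :: "real \<Rightarrow> real \<Rightarrow> real"
  assumes "open U" "\<And>x t. (x, t) \<in> U \<Longrightarrow> f x t = g x t" "(x, t) \<in> U"
  shows "deriv_x f x t = deriv_x g x t"
  unfolding deriv_x_def deriv_def using has_deriv_x_cong[of U f g, OF assms] by presburger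

lemma deriv_t_cong:
  fixes f g :: "real \<Rightarrow> real \<Rightarrow> real"
  assumes "open U" "\<And>x t. (x, t) \<in> U \<Longrightarrow> f x t = g x t" "(x, t) \<in> U"
  shows "deriv_t f x t = deriv_t g x t"
  unfolding deriv_t_def deriv_def using has_deriv_t_cong[of U f g, OF assms] by presburger

text \<open>
  Regularity on an open set depends only on the values there. A formula for \<open>f\<^sub>x\<close> that is valid
  only on \<open>U\<close> can thus replace \<open>deriv_x f\<close>, although the two functions may differ outside \<open>U\<close>.
\<close>

lemma C_k_on_cong:
  assumes "open U" "\<And>x t. (x, t) \<in> U \<Longrightarrow> f x t = g x t" "C_k_on k U f"
  shows "C_k_on k U g"
  using assms(2,3)
proof (induction k arbitrary: f g)
  case 0
  then have "continuous_on U (\<lambda>(x, t). f x t) \<longleftrightarrow> continuous_on U (\<lambda>(x, t). g x t)"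
    by (intro continuous_on_cong) auto
  then show ?case using 0 by simp
next
  case (Suc k)
  have "continuous_on U (\<lambda>(x, t). f x t) \<longleftrightarrow> continuous_on U (\<lambda>(x, t). g x t)"
    using Suc.prems by (intro continuous_on_cong) auto
  moreover have "C_k_on k U (deriv_x g)" "C_k_on k U (deriv_t g)"
    using Suc.IH[of "deriv_x f" "deriv_x g"] Suc.IH[of "deriv_t f" "deriv_t g"] Suc.prems(2)
      deriv_x_cong[of U f g] deriv_t_cong[of U f g] Suc.prems(1) assms(1) by auto
  moreover have "(\<lambda>y. g y t) differentiable (at x) \<and> (\<lambda>s. g x s) differentiable (at t)"
    if "(x, t) \<in> U" for x t
    using C_k_on_has_deriv_x[OF Suc.prems(2) that] C_k_on_has_deriv_t[OF Suc.prems(2) that]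
      has_deriv_x_cong[of U f g, OF assms(1) Suc.prems(1) that] has_deriv_t_cong[of U f g, OF assms(1) Suc.prems(1) that]
    unfolding real_differentiable_def by blast
  ultimately show ?case using Suc.prems by auto
qed

lemma C_k_on_SucI:
  assumes "open U"
    and fx: "\<And>x t. (x, t) \<in> U \<Longrightarrow> ((\<lambda>y. f y t) has_real_derivative fx x t) (at x)"
    and ft: "\<And>x t. (x, t) \<in> U \<Longrightarrow> ((\<lambda>s. f x s) has_real_derivative ft x t) (at t)"
    and "continuous_on U (\<lambda>(x, t). f x t)" "C_k_on k U fx" "C_k_on k U ft"
  shows "C_k_on (Suc k) U f"
proof -
  have "C_k_on k U (deriv_x f)"
    using assms(1) _ assms(5) by (rule C_k_on_cong) (simp add: deriv_x_def DERIV_imp_deriv[OF fx])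
  moreover have "C_k_on k U (deriv_t f)"
    using assms(1) _ assms(6) by (rule C_k_on_cong) (simp add: deriv_t_def DERIV_imp_deriv[OF ft])
  moreover have "(\<lambda>y. f y t) differentiable (at x) \<and> (\<lambda>s. f x s) differentiable (at t)"
    if "(x, t) \<in> U" for x t
    using fx[OF that] ft[OF that] unfolding real_differentiable_def by blast
  ultimately show ?thesis
    using assms(4) by auto
qed

lemma C_k_on_const:
  assumes "open U"
  shows "C_k_on k U (\<lambda>_ _. c)"
proof (induction k arbitrary: c)
  case (Suc k)
  show ?case
    by (rule C_k_on_SucI[where fx = "\<lambda>_ _. 0" and ft = "\<lambda>_ _. 0"]) (auto simp: assms Suc)
qed simp

lemma C_k_on_add:
  assumes "open U" "C_k_on k U f" "C_k_on k U g"
  shows "C_k_on k U (\<lambda>x t. f x t + g x t)"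
  using assms(2,3)
proof (induction k arbitrary: f g)
  case 0
  then show ?case by (auto simp: case_prod_unfold intro!: continuous_intros)
next
  case (Suc k)
  show ?case
  proof (rule C_k_on_SucI[where fx = "\<lambda>x t. deriv_x f x t + deriv_x g x t"
        and ft = "\<lambda>x t. deriv_t f x t + deriv_t g x t"])
    show "continuous_on U (\<lambda>(x, t). f x t + g x t)"
      using C_k_on_continuous[OF Suc.prems(1)] C_k_on_continuous[OF Suc.prems(2)]
      by (auto simp: case_prod_unfold intro!: continuous_intros)
    show "C_k_on k U (\<lambda>x t. deriv_x f x t + deriv_x g x t)"
      "C_k_on k U (\<lambda>x t. deriv_t f x t + deriv_t g x t)"
      using Suc by auto
  qed (use assms(1) in \<open>auto intro!: DERIV_add C_k_on_has_deriv_x[OF Suc.prems(1)] C_k_on_has_deriv_t[OF Suc.prems(1)]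
         C_k_on_has_deriv_x[OF Suc.prems(2)] C_k_on_has_deriv_t[OF Suc.prems(2)]\<close>)
qed

lemma C_k_on_mult:
  assumes "open U" "C_k_on k U f" "C_k_on k U g"
  shows "C_k_on k U (\<lambda>x t. f x t * g x t)"
  using assms(2,3)
proof (induction k arbitrary: f g)
  case 0
  then show ?case by (auto simp: case_prod_unfold intro!: continuous_intros)
next
  case (Suc k)
  note f = Suc.prems(1) and g = Suc.prems(2)
  show ?case
  proof (rule C_k_on_SucI[where fx = "\<lambda>x t. deriv_x f x t * g x t + deriv_x g x t * f x t"
        and ft = "\<lambda>x t. deriv_t f x t * g x t + deriv_t g x t * f x t"])
    show "continuous_on U (\<lambda>(x, t). f x t * g x t)"
      using C_k_on_continuous[OF f] C_k_on_continuous[OF g]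
      by (auto simp: case_prod_unfold intro!: continuous_intros)
    show "C_k_on k U (\<lambda>x t. deriv_x f x t * g x t + deriv_x g x t * f x t)"
      "C_k_on k U (\<lambda>x t. deriv_t f x t * g x t + deriv_t g x t * f x t)"
      using assms(1) f g by (auto intro!: C_k_on_add Suc.IH C_k_on_Suc_imp[OF f] C_k_on_Suc_imp[OF g])
  qed (use assms(1) in \<open>auto intro!: DERIV_mult C_k_on_has_deriv_x[OF f] C_k_on_has_deriv_t[OF f]
         C_k_on_has_deriv_x[OF g] C_k_on_has_deriv_t[OF g]\<close>)
qed

text \<open>
  Two applications of the mean value theorem, first in the first variable and then in the second. The
  left-hand side is symmetric in the two variables, which is what yields equality of mixed derivatives.
\<close>

lemma mixed_difference_mean_value:
  fixes f fx fxt :: "real \<Rightarrow> real \<Rightarrow> real"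
  assumes "0 < h"
    and fx: "\<And>y s. x \<le> y \<Longrightarrow> y \<le> x + h \<Longrightarrow> t \<le> s \<Longrightarrow> s \<le> t + h \<Longrightarrow>
      ((\<lambda>y. f y s) has_real_derivative fx y s) (at y)"
    and fxt: "\<And>y s. x \<le> y \<Longrightarrow> y \<le> x + h \<Longrightarrow> t \<le> s \<Longrightarrow> s \<le> t + h \<Longrightarrow>
      ((\<lambda>s. fx y s) has_real_derivative fxt y s) (at s)"
  obtains y s where "x < y" "y < x + h" "t < s" "s < t + h"
    "f (x + h) (t + h) - f x (t + h) - (f (x + h) t - f x t) = h\<^sup>2 * fxt y s"
proof -
  have "\<exists>y>x. y < x + h \<and> (f (x + h) (t + h) - f (x + h) t) - (f x (t + h) - f x t)
      = (x + h - x) * (fx y (t + h) - fx y t)"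
    by (rule MVT2) (use assms(1) in \<open>auto intro!: DERIV_diff fx\<close>)
  then obtain y where y: "x < y" "y < x + h" "(f (x + h) (t + h) - f (x + h) t) - (f x (t + h) - f x t)
      = h * (fx y (t + h) - fx y t)" by auto
  have "\<exists>s>t. s < t + h \<and> fx y (t + h) - fx y t = (t + h - t) * fxt y s"
    by (rule MVT2) (use assms(1) y in \<open>auto intro!: fxt\<close>)
  then obtain s where s: "t < s" "s < t + h" "fx y (t + h) - fx y t = h * fxt y s" by auto
  show thesis using that[OF y(1,2) s(1,2)] y(3) s(3) by (simp add: power2_eq_square algebra_simps)
qed

text \<open>
  On arbitrarily small squares at \<open>(x, t)\<close> the second mixed difference is a value of either mixed
  derivative, so the two share values arbitrarily close to the point; both being continuous, they agree.
\<close>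

lemma deriv_t_deriv_x_commute:
  assumes "open U" "(x, t) \<in> U" "C_k_on (Suc (Suc 0)) U f"
  shows "deriv_t (deriv_x f) x t = deriv_x (deriv_t f) x t"
proof (rule ccontr)
  let ?A = "\<lambda>z. deriv_t (deriv_x f) (fst z) (snd z)"
  let ?B = "\<lambda>z. deriv_x (deriv_t f) (fst z) (snd z)"
  assume neq: "deriv_t (deriv_x f) x t \<noteq> deriv_x (deriv_t f) x t"
  note fx = C_k_on_deriv_x[OF assms(3)] and ft = C_k_on_deriv_t[OF assms(3)]
  define \<epsilon> where "\<epsilon> = dist (?A (x, t)) (?B (x, t)) / 2"
  have "\<epsilon> > 0" using neq by (simp add: \<epsilon>_def)
  have "isCont ?A (x, t)" "isCont ?B (x, t)"
    using C_k_on_continuous[OF C_k_on_deriv_t[OF fx]] C_k_on_continuous[OF C_k_on_deriv_x[OF ft]] assms(1,2)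
    by (auto simp: case_prod_unfold continuous_on_eq_continuous_at)
  then have "\<forall>\<^sub>F z in nhds (x, t). dist (?A z) (?A (x, t)) < \<epsilon> \<and> dist (?B z) (?B (x, t)) < \<epsilon> \<and> z \<in> U"
    using assms(1,2) \<open>\<epsilon> > 0\<close>
    by (intro eventually_conj tendstoD eventually_nhds_in_open)
       (auto simp: isCont_def tendsto_nhds_iff)
  then obtain d where d: "d > 0" and dP: "\<And>z. dist z (x, t) < d \<Longrightarrow>
      dist (?A z) (?A (x, t)) < \<epsilon> \<and> dist (?B z) (?B (x, t)) < \<epsilon> \<and> z \<in> U"
    unfolding eventually_nhds_metric by blast
  have box: "dist (y, s) (x, t) < d"
    if "x \<le> y" "y \<le> x + d / 3" "t \<le> s" "s \<le> t + d / 3" for y s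
  proof -
    have "dist (y, s) (x, t) \<le> dist y x + dist s t"
      unfolding dist_Pair_Pair by (rule sqrt_sum_squares_le_sum) auto
    also have "\<dots> < d" using that d by (auto simp: dist_real_def)
    finally show ?thesis .
  qed
  have inU: "(y, s) \<in> U" if "x \<le> y" "y \<le> x + d / 3" "t \<le> s" "s \<le> t + d / 3" for y s
    using dP box that by blast
  have d3: "0 < d / 3" using d by simp
  obtain y s where 1: "x < y" "y < x + d / 3" "t < s" "s < t + d / 3"
    "f (x + d / 3) (t + d / 3) - f x (t + d / 3) - (f (x + d / 3) t - f x t) = (d / 3)\<^sup>2 * deriv_t (deriv_x f) y s"
    by (rule mixed_difference_mean_value[OF d3, of x t f "deriv_x f" "deriv_t (deriv_x f)"])
       (auto intro!: inU C_k_on_has_deriv_x[OF assms(3)] C_k_on_has_deriv_t[OF fx])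
  obtain s' y' where 2: "t < s'" "s' < t + d / 3" "x < y'" "y' < x + d / 3"
    "f (x + d / 3) (t + d / 3) - f (x + d / 3) t - (f x (t + d / 3) - f x t) = (d / 3)\<^sup>2 * deriv_x (deriv_t f) y' s'"
    by (rule mixed_difference_mean_value[OF d3, of t x "\<lambda>s y. f y s" "\<lambda>s y. deriv_t f y s" "\<lambda>s y. deriv_x (deriv_t f) y s"])
       (auto intro!: inU C_k_on_has_deriv_t[OF assms(3)] C_k_on_has_deriv_x[OF ft])
  have "(d / 3)\<^sup>2 * deriv_t (deriv_x f) y s = (d / 3)\<^sup>2 * deriv_x (deriv_t f) y' s'"
    using 1(5) 2(5) by linarith
  then have "?A (y, s) = ?B (y', s')" using d by simp
  moreover have "dist (?A (y, s)) (?A (x, t)) < \<epsilon>" "dist (?B (y', s')) (?B (x, t)) < \<epsilon>"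
    using dP[OF box, of y s] dP[OF box, of y' s'] 1 2 by auto
  ultimately have "dist (?A (x, t)) (?B (x, t)) < \<epsilon> + \<epsilon>"
    unfolding dist_real_def by linarith
  then show False by (simp add: \<epsilon>_def)
qed

section \<open>Functions that vary with the step size\<close>

text \<open>
  Asymptotics are taken jointly in the step \<open>h\<close> and the space variable \<open>y\<close>: a property holds eventually
  along this filter if it holds for all small \<open>h > 0\<close> and all \<open>y\<close> in a fixed neighbourhood of \<open>x\<close>. Such
  bounds are uniform in \<open>y\<close>, so they survive shifting \<open>y\<close> by multiples of \<open>h\<close>.
\<close>

abbreviation mesh :: "real \<Rightarrow> (real \<times> real) filter" where
  "mesh x \<equiv> at_right 0 \<times>\<^sub>F nhds x"

lemma eventually_mesh_snd:
  "eventually P (nhds x) \<Longrightarrow> \<forall>\<^sub>F z in mesh x. P (snd z)"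
  unfolding eventually_prod_filter by (intro exI[of _ "\<lambda>_. True"] exI[of _ P]) auto

lemma eventually_mesh_fst:
  "eventually P (at_right 0) \<Longrightarrow> \<forall>\<^sub>F z in mesh x. P (fst z)"
  unfolding eventually_prod_filter by (intro exI[of _ "\<lambda>_. True"] exI[of _ P]) auto

lemma eventually_mesh_step_pos: "\<forall>\<^sub>F z in mesh x. 0 < fst z"
  by (intro eventually_mesh_fst eventually_at_right_less)

text \<open>
  Points within \<open>w h\<close> of \<open>y\<close> stay in the neighbourhood of \<open>x\<close> once \<open>h\<close> is small and \<open>y\<close> is in the
  neighbourhood of half the size.
\<close>

lemma eventually_mesh_stencil:
  assumes "eventually P (mesh x)"
  shows "\<forall>\<^sub>F z in mesh x. \<forall>y. \<bar>y - snd z\<bar> \<le> w * fst z \<longrightarrow> P (fst z, y)"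
proof -
  obtain P1 P2 where P: "eventually P1 (at_right 0)" "eventually P2 (nhds x)"
    "\<And>h y. P1 h \<Longrightarrow> P2 y \<Longrightarrow> P (h, y)"
    using assms unfolding eventually_prod_filter by blast
  obtain d where d: "d > 0" "\<And>y. dist y x < d \<Longrightarrow> P2 y"
    using P(2) unfolding eventually_nhds_metric by blast
  have "((\<lambda>h. w * h) \<longlongrightarrow> w * 0) (at_right (0 :: real))"
    by (intro tendsto_intros)
  then have "\<forall>\<^sub>F h in at_right 0. w * h < d / 2"
    using d(1) by (intro order_tendstoD) auto
  then have 1: "\<forall>\<^sub>F h in at_right 0. P1 h \<and> w * h < d / 2"
    using P(1) by (simp add: eventually_conj)
  have 2: "\<forall>\<^sub>F y in nhds x. dist y x < d / 2"
    unfolding eventually_nhds_metric using d(1) by (intro exI[of _ "d / 2"]) auto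
  show ?thesis
    unfolding eventually_prod_filter
  proof (intro exI conjI allI impI)
    fix h y y' assume *: "P1 h \<and> w * h < d / 2" "dist y x < d / 2" "\<bar>y' - snd (h, y)\<bar> \<le> w * fst (h, y)"
    then have "dist y' x < d" unfolding dist_real_def fst_conv snd_conv by linarith
    then show "P (fst (h, y), y')" using P(3) d(2) * by auto
  qed (use 1 2 in auto)
qed

lemma eventually_mesh_shift:
  assumes "eventually P (mesh x)"
  shows "\<forall>\<^sub>F z in mesh x. P (fst z, snd z + v * fst z)"
  using eventually_mesh_stencil[OF assms, of "\<bar>v\<bar>"] eventually_mesh_step_pos[of x]
  by eventually_elim (simp add: abs_mult)

lemma filterlim_mesh_shift: "filterlim (\<lambda>h. (h, x + v * h)) (mesh x) (at_right 0)"
proof (rule filterlim_Pair)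
  have "((\<lambda>h. x + v * h) \<longlongrightarrow> x + v * 0) (at_right 0)" by (intro tendsto_intros)
  then show "((\<lambda>h. x + v * h) \<longlongrightarrow> x) (at_right 0)" by simp
qed (rule filterlim_ident)

lemma step_power_bigo_mono:
  assumes "p \<le> q"
  shows "(\<lambda>z. fst z ^ q) \<in> O[mesh x](\<lambda>z. fst z ^ p :: real)"
proof (rule bigoI[where c = 1])
  have "\<forall>\<^sub>F h in at_right 0. h < (1 :: real)" by (rule eventually_at_right_field[THEN iffD2]) (auto intro: exI[of _ 1])
  from eventually_mesh_fst[OF this, of x] eventually_mesh_step_pos[of x]
  show "\<forall>\<^sub>F z in mesh x. norm (fst z ^ q) \<le> 1 * norm (fst z ^ p :: real)"
    by eventually_elim (auto intro: power_decreasing assms)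
qed

text \<open>
  \<open>small x p m e\<close> says that \<open>e\<close> is \<open>O(h\<^sup>p)\<close> in \<open>C\<^sup>m\<close> near \<open>x\<close>. Keeping the bounds on the derivatives
  makes it possible to apply difference quotients to error terms.
\<close>

fun small :: "real \<Rightarrow> nat \<Rightarrow> nat \<Rightarrow> (real \<Rightarrow> real \<Rightarrow> real) \<Rightarrow> bool" where
  "small x p 0 e \<longleftrightarrow> (\<lambda>z. e (fst z) (snd z)) \<in> O[mesh x](\<lambda>z. fst z ^ p)"
| "small x p (Suc m) e \<longleftrightarrow>
     (\<lambda>z. e (fst z) (snd z)) \<in> O[mesh x](\<lambda>z. fst z ^ p) \<and>
     (\<exists>e'. (\<forall>\<^sub>F z in mesh x. (e (fst z) has_real_derivative e' (fst z) (snd z)) (at (snd z))) \<and>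
           small x p m e')"

lemma small_imp_bigo: "small x p m e \<Longrightarrow> (\<lambda>z. e (fst z) (snd z)) \<in> O[mesh x](\<lambda>z. fst z ^ p)"
  by (cases m) auto

lemma small_SucI:
  assumes "(\<lambda>z. e (fst z) (snd z)) \<in> O[mesh x](\<lambda>z. fst z ^ p)"
    "\<forall>\<^sub>F z in mesh x. (e (fst z) has_real_derivative e' (fst z) (snd z)) (at (snd z))"
    "small x p m e'"
  shows "small x p (Suc m) e"
  using assms by auto

lemma small_SucE:
  assumes "small x p (Suc m) e"
  obtains e' where "\<forall>\<^sub>F z in mesh x. (e (fst z) has_real_derivative e' (fst z) (snd z)) (at (snd z))"
    "small x p m e'"
  using assms by auto

lemma small_Suc_imp: "small x p (Suc m) e \<Longrightarrow> small x p m e"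
proof (induction m arbitrary: e)
  case 0
  then show ?case by simp
next
  case (Suc m)
  from Suc.prems obtain e' where e': "\<forall>\<^sub>F z in mesh x. (e (fst z) has_real_derivative e' (fst z) (snd z)) (at (snd z))"
    "small x p (Suc m) e'" by (rule small_SucE)
  show ?case
    by (rule small_SucI[OF small_imp_bigo[OF Suc.prems] e'(1) Suc.IH[OF e'(2)]])
qed

lemma small_weaken:
  assumes "small x q m e" "p \<le> q"
  shows "small x p m e"
  using assms(1)
proof (induction m arbitrary: e)
  case 0
  then show ?case using landau_o.big_trans[OF small_imp_bigo[OF 0] step_power_bigo_mono[OF assms(2)]] by simp
next
  case (Suc m)
  from Suc.prems obtain e' where e': "\<forall>\<^sub>F z in mesh x. (e (fst z) has_real_derivative e' (fst z) (snd z)) (at (snd z))"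
    "small x q m e'" by (rule small_SucE)
  show ?case
    by (rule small_SucI[OF landau_o.big_trans[OF small_imp_bigo[OF Suc.prems] step_power_bigo_mono[OF assms(2)]]
          e'(1) Suc.IH[OF e'(2)]])
qed

lemma small_add:
  assumes "small x p m e" "small x p m f"
  shows "small x p m (\<lambda>h y. e h y + f h y)"
  using assms
proof (induction m arbitrary: e f)
  case 0
  then show ?case by (auto intro: sum_in_bigo)
next
  case (Suc m)
  from Suc.prems(1) obtain e' where e': "\<forall>\<^sub>F z in mesh x. (e (fst z) has_real_derivative e' (fst z) (snd z)) (at (snd z))"
    "small x p m e'" by (rule small_SucE)
  from Suc.prems(2) obtain f' where f': "\<forall>\<^sub>F z in mesh x. (f (fst z) has_real_derivative f' (fst z) (snd z)) (at (snd z))"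
    "small x p m f'" by (rule small_SucE)
  show ?case
  proof (rule small_SucI[where e' = "\<lambda>h y. e' h y + f' h y"])
    show "\<forall>\<^sub>F z in mesh x. ((\<lambda>y. e (fst z) y + f (fst z) y) has_real_derivative
        e' (fst z) (snd z) + f' (fst z) (snd z)) (at (snd z))"
      using e'(1) f'(1) by eventually_elim (rule DERIV_add)
  qed (use Suc e' f' in \<open>auto intro: sum_in_bigo\<close>)
qed

lemma small_mult:
  assumes "small x p m e" "small x q m f"
  shows "small x (p + q) m (\<lambda>h y. e h y * f h y)"
  using assms
proof (induction m arbitrary: e f)
  case 0
  then show ?case by (auto simp: power_add intro: landau_o.big.mult)
next
  case (Suc m)
  from Suc.prems(1) obtain e' where e': "\<forall>\<^sub>F z in mesh x. (e (fst z) has_real_derivative e' (fst z) (snd z)) (at (snd z))"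
    "small x p m e'" by (rule small_SucE)
  from Suc.prems(2) obtain f' where f': "\<forall>\<^sub>F z in mesh x. (f (fst z) has_real_derivative f' (fst z) (snd z)) (at (snd z))"
    "small x q m f'" by (rule small_SucE)
  show ?case
  proof (rule small_SucI[where e' = "\<lambda>h y. e' h y * f h y + e h y * f' h y"])
    show "(\<lambda>z. e (fst z) (snd z) * f (fst z) (snd z)) \<in> O[mesh x](\<lambda>z. fst z ^ (p + q))"
      unfolding power_add by (intro landau_o.big.mult small_imp_bigo[OF Suc.prems(1)] small_imp_bigo[OF Suc.prems(2)])
    show "\<forall>\<^sub>F z in mesh x. ((\<lambda>y. e (fst z) y * f (fst z) y) has_real_derivative
        e' (fst z) (snd z) * f (fst z) (snd z) + e (fst z) (snd z) * f' (fst z) (snd z)) (at (snd z))"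
      using e'(1) f'(1) by eventually_elim (auto intro!: derivative_eq_intros)
    show "small x (p + q) m (\<lambda>h y. e' h y * f h y + e h y * f' h y)"
      by (intro small_add Suc.IH e'(2) f'(2) small_Suc_imp[OF Suc.prems(1)] small_Suc_imp[OF Suc.prems(2)])
  qed
qed

lemma bigo_const_of_isCont:
  assumes "isCont g (x :: real)"
  shows "(\<lambda>z. g (snd z) :: real) \<in> O[mesh x](\<lambda>z. 1)"
proof (rule bigoI[where c = "\<bar>g x\<bar> + 1"])
  have "(g \<longlongrightarrow> g x) (nhds x)" using assms by (simp add: isCont_def tendsto_nhds_iff)
  then have "\<forall>\<^sub>F y in nhds x. dist (g y) (g x) < 1" by (rule tendstoD) simp
  then have "\<forall>\<^sub>F y in nhds x. norm (g y) \<le> (\<bar>g x\<bar> + 1) * norm (1 :: real)"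
    by eventually_elim (auto simp: dist_real_def)
  then show "\<forall>\<^sub>F z in mesh x. norm (g (snd z)) \<le> (\<bar>g x\<bar> + 1) * norm (1 :: real)"
    by (rule eventually_mesh_snd)
qed

lemma C_k_on_isCont_x:
  assumes "open U" "(x, t) \<in> U" "C_k_on k U f"
  shows "isCont (\<lambda>y. f y t) x"
proof -
  have "isCont (\<lambda>(y, s). f y s) (x, t)"
    using C_k_on_continuous[OF assms(3)] assms(1,2) by (simp add: continuous_on_eq_continuous_at)
  moreover have "isCont (\<lambda>y. (y, t)) x"
    by (intro continuous_intros)
  ultimately show ?thesis
    using isCont_o2[where f = "\<lambda>y. (y, t)" and g = "\<lambda>(y, s). f y s" and a = x] by simp
qed

lemma C_k_on_isCont_t:
  assumes "open U" "(x, t) \<in> U" "C_k_on k U f"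
  shows "isCont (\<lambda>s. f x s) t"
proof -
  have "isCont (\<lambda>(y, s). f y s) (x, t)"
    using C_k_on_continuous[OF assms(3)] assms(1,2) by (simp add: continuous_on_eq_continuous_at)
  moreover have "isCont (\<lambda>s. (x, s)) t"
    by (intro continuous_intros)
  ultimately show ?thesis
    using isCont_o2[where f = "\<lambda>s. (x, s)" and g = "\<lambda>(y, s). f y s" and a = t] by simp
qed

lemma small_of_C_k_on:
  assumes "open U" "(x, t) \<in> U" "C_k_on m U f"
  shows "small x 0 m (\<lambda>_ y. f y t)"
  using assms(3)
proof (induction m arbitrary: f)
  case 0
  then show ?case using bigo_const_of_isCont[OF C_k_on_isCont_x[OF assms(1,2) 0]] by simp
next
  case (Suc m)
  show ?case
  proof (rule small_SucI[where e' = "\<lambda>_ y. deriv_x f y t"])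
    show "\<forall>\<^sub>F z in mesh x. ((\<lambda>y. f y t) has_real_derivative deriv_x f (snd z) t) (at (snd z))"
      by (rule eventually_mesh_snd, rule eventually_mono[OF eventually_slice_x[OF assms(1,2)]])
         (rule C_k_on_has_deriv_x[OF Suc.prems])
  qed (use bigo_const_of_isCont[OF C_k_on_isCont_x[OF assms(1,2) Suc.prems]] Suc in auto)
qed

section \<open>Central differences\<close>

definition cdiff :: "real \<Rightarrow> (real \<Rightarrow> real \<Rightarrow> real) \<Rightarrow> real \<Rightarrow> real \<Rightarrow> real" where
  "cdiff w e h y = (e h (y + w * h) - e h (y - w * h)) / (2 * w * h)"

text \<open>
  By the mean value theorem the difference quotient of \<open>e\<close> is a value of \<open>e'\<close> nearby, so the division by
  \<open>h\<close> costs a derivative instead of a power of \<open>h\<close>.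
\<close>

lemma cdiff_bigo:
  assumes "w > 0"
    and "\<forall>\<^sub>F z in mesh x. (e (fst z) has_real_derivative e' (fst z) (snd z)) (at (snd z))"
    and "(\<lambda>z. e' (fst z) (snd z)) \<in> O[mesh x](\<lambda>z. fst z ^ p)"
  shows "(\<lambda>z. cdiff w e (fst z) (snd z)) \<in> O[mesh x](\<lambda>z. fst z ^ p)"
proof -
  obtain C where C: "\<forall>\<^sub>F z in mesh x. norm (e' (fst z) (snd z)) \<le> C * norm (fst z ^ p)"
    using assms(3) by (auto elim: landau_o.bigE)
  show ?thesis
  proof (rule bigoI[where c = C])
    show "\<forall>\<^sub>F z in mesh x. norm (cdiff w e (fst z) (snd z)) \<le> C * norm (fst z ^ p)"
      using eventually_mesh_stencil[OF eventually_conj[OF assms(2) C], of w] eventually_mesh_step_pos[of x]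
    proof eventually_elim
      fix z :: "real \<times> real"
      assume *: "\<forall>y. \<bar>y - snd z\<bar> \<le> w * fst z \<longrightarrow>
        (e (fst (fst z, y)) has_real_derivative e' (fst (fst z, y)) (snd (fst z, y))) (at (snd (fst z, y))) \<and>
        norm (e' (fst (fst z, y)) (snd (fst z, y))) \<le> C * norm (fst (fst z, y) ^ p)" and h: "0 < fst z"
      define h y where "h = fst z" and "y = snd z"
      have wh: "w * h > 0" using h assms(1) by (simp add: h_def)
      have "\<exists>\<xi>>y - w * h. \<xi> < y + w * h \<and> e h (y + w * h) - e h (y - w * h) = (y + w * h - (y - w * h)) * e' h \<xi>"
        using wh * by (intro MVT2) (auto simp: h_def y_def)
      then obtain \<xi> where \<xi>: "\<xi> > y - w * h" "\<xi> < y + w * h" "e h (y + w * h) - e h (y - w * h) = 2 * (w * h) * e' h \<xi>"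
        by auto
      moreover have "w \<noteq> 0" "h \<noteq> 0" using assms(1) h by (auto simp: h_def)
      ultimately have "cdiff w e h y = e' h \<xi>" by (simp add: cdiff_def)
      moreover have "norm (e' h \<xi>) \<le> C * norm (h ^ p)"
        using \<xi>(1,2) *[rule_format, of \<xi>] by (auto simp: h_def y_def)
      ultimately show "norm (cdiff w e (fst z) (snd z)) \<le> C * norm (fst z ^ p)"
        by (simp add: h_def y_def)
    qed
  qed
qed

lemma cdiff_has_derivative:
  assumes "w > 0"
    and "\<forall>\<^sub>F z in mesh x. (e (fst z) has_real_derivative e' (fst z) (snd z)) (at (snd z))"
  shows "\<forall>\<^sub>F z in mesh x. (cdiff w e (fst z) has_real_derivative cdiff w e' (fst z) (snd z)) (at (snd z))"
  using eventually_mesh_shift[OF assms(2), of w] eventually_mesh_shift[OF assms(2), of "- w"] eventually_mesh_step_pos[of x]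
proof eventually_elim
  fix z :: "real \<times> real"
  define h y where "h = fst z" and "y = snd z"
  assume *: "(e (fst (fst z, snd z + w * fst z)) has_real_derivative e' (fst (fst z, snd z + w * fst z)) (snd (fst z, snd z + w * fst z))) (at (snd (fst z, snd z + w * fst z)))"
    "(e (fst (fst z, snd z + - w * fst z)) has_real_derivative e' (fst (fst z, snd z + - w * fst z)) (snd (fst z, snd z + - w * fst z))) (at (snd (fst z, snd z + - w * fst z)))"
    "0 < fst z"
  have "((\<lambda>y. e h (y + w * h)) has_real_derivative e' h (y + w * h)) (at y)"
    using *(1) by (simp add: h_def y_def DERIV_shift)
  moreover have "((\<lambda>y. e h (y + - (w * h))) has_real_derivative e' h (y + - (w * h))) (at y)"
    using *(2) by (subst DERIV_shift[symmetric]) (simp add: h_def y_def)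
  ultimately have "((\<lambda>y. (e h (y + w * h) - e h (y - w * h)) / (2 * w * h)) has_real_derivative
      (e' h (y + w * h) - e' h (y - w * h)) / (2 * w * h)) (at y)"
    by (intro DERIV_cdivide DERIV_diff) simp_all
  then show "(cdiff w e (fst z) has_real_derivative cdiff w e' (fst z) (snd z)) (at (snd z))"
    by (simp add: cdiff_def[abs_def] h_def y_def)
qed

lemma small_cdiff:
  assumes "w > 0" "small x p (Suc m) e"
  shows "small x p m (cdiff w e)"
  using assms(2)
proof (induction m arbitrary: e)
  case 0
  then show ?case using cdiff_bigo[OF assms(1)] by auto
next
  case (Suc m)
  from Suc.prems obtain e' where e': "\<forall>\<^sub>F z in mesh x. (e (fst z) has_real_derivative e' (fst z) (snd z)) (at (snd z))"
    "small x p (Suc m) e'" by (rule small_SucE)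
  show ?case
    by (rule small_SucI[OF cdiff_bigo[OF assms(1) e'(1) small_imp_bigo[OF e'(2)]]
          cdiff_has_derivative[OF assms(1) e'(1)] Suc.IH[OF e'(2)]])
qed

text \<open>
  Taylor's formula, uniformly in the base point \<open>y\<close>. The offset is the step itself up to the
  factor \<open>v\<close>, so that the left, right and half-cell expansions are all instances. The sequence \<open>diff\<close>
  consists of the successive derivatives.
\<close>

lemma taylor_bigo:
  fixes diff :: "nat \<Rightarrow> real \<Rightarrow> real"
  assumes "n > 0"
    and D: "\<forall>\<^sub>F z in nhds x. \<forall>m<n. (diff m has_real_derivative diff (Suc m) z) (at z)"
    and "isCont (diff n) x"
  shows "(\<lambda>z. diff 0 (snd z + v * fst z) - (\<Sum>m<n. diff m (snd z) / fact m * (v * fst z) ^ m))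
    \<in> O[mesh x](\<lambda>z. fst z ^ n)"
proof -
  obtain C where C: "\<forall>\<^sub>F z in mesh x. norm (diff n (snd z)) \<le> C * norm (1 :: real)"
    using bigo_const_of_isCont[OF assms(3)] by (auto elim: landau_o.bigE)
  show ?thesis
  proof (rule bigoI[where c = "\<bar>v\<bar> ^ n * C"])
    show "\<forall>\<^sub>F z in mesh x. norm (diff 0 (snd z + v * fst z) - (\<Sum>m<n. diff m (snd z) / fact m * (v * fst z) ^ m))
        \<le> \<bar>v\<bar> ^ n * C * norm (fst z ^ n)"
      using eventually_mesh_stencil[OF eventually_conj[OF eventually_mesh_snd[OF D] C], of "\<bar>v\<bar>"] eventually_mesh_step_pos[of x]
    proof eventually_elim
      fix z :: "real \<times> real"
      assume "\<forall>y. \<bar>y - snd z\<bar> \<le> \<bar>v\<bar> * fst z \<longrightarrow>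
        (\<forall>m<n. (diff m has_real_derivative diff (Suc m) (snd (fst z, y))) (at (snd (fst z, y)))) \<and>
        norm (diff n (snd (fst z, y))) \<le> C * norm (1 :: real)" and "0 < fst z"
      moreover define h y where "h = fst z" and "y = snd z"
      ultimately have h: "0 < h" and *: "\<And>m \<xi>. \<bar>\<xi> - y\<bar> \<le> \<bar>v\<bar> * h \<Longrightarrow> m < n \<Longrightarrow>
            (diff m has_real_derivative diff (Suc m) \<xi>) (at \<xi>)"
          "\<And>\<xi>. \<bar>\<xi> - y\<bar> \<le> \<bar>v\<bar> * h \<Longrightarrow> \<bar>diff n \<xi>\<bar> \<le> C"
        by auto
      have "\<bar>diff 0 (y + v * h) - (\<Sum>m<n. diff m y / fact m * (v * h) ^ m)\<bar> \<le> \<bar>v\<bar> ^ n * C * h ^ n"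
      proof (cases "v = 0")
        case True
        then have "(\<Sum>m<n. diff m y / fact m * (v * h) ^ m) = (\<Sum>m<n. if m = 0 then diff m y else 0)"
          by (intro sum.cong) auto
        then show ?thesis using True \<open>n > 0\<close> by (simp add: power_0_left)
      next
        case False
        define a b where "a = y - \<bar>v\<bar> * h" and "b = y + \<bar>v\<bar> * h"
        have vh: "\<bar>v * h\<bar> = \<bar>v\<bar> * h" using h by (simp add: abs_mult)
        have "\<exists>\<xi>. (if y + v * h < y then y + v * h < \<xi> \<and> \<xi> < y else y < \<xi> \<and> \<xi> < y + v * h) \<and>
          diff 0 (y + v * h) = (\<Sum>m<n. diff m y / fact m * (y + v * h - y) ^ m) + diff n \<xi> / fact n * (y + v * h - y) ^ n"
        proof (rule Taylor[where a = a and b = b])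
          show "\<forall>m t. m < n \<and> a \<le> t \<and> t \<le> b \<longrightarrow> (diff m has_real_derivative diff (Suc m) t) (at t)"
            using * by (auto simp: a_def b_def abs_le_iff)
        qed (use False h vh \<open>n > 0\<close> in \<open>auto simp: a_def b_def\<close>)
        then obtain \<xi> where \<xi>: "if y + v * h < y then y + v * h < \<xi> \<and> \<xi> < y else y < \<xi> \<and> \<xi> < y + v * h"
          "diff 0 (y + v * h) - (\<Sum>m<n. diff m y / fact m * (v * h) ^ m) = diff n \<xi> / fact n * (v * h) ^ n"
          by auto
        have "\<bar>\<xi> - y\<bar> \<le> \<bar>v\<bar> * h" using \<xi>(1) vh by (auto split: if_splits)
        then have le: "\<bar>diff n \<xi>\<bar> \<le> C" by (rule *)
        have "\<bar>diff n \<xi>\<bar> / fact n \<le> \<bar>diff n \<xi>\<bar> / 1"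
          by (intro divide_left_mono) (auto simp: fact_ge_1)
        then have "\<bar>diff n \<xi> / fact n * (v * h) ^ n\<bar> \<le> C * (\<bar>v\<bar> * h) ^ n"
          using le h unfolding abs_mult power_abs vh abs_divide by (intro mult_mono) auto
        then show ?thesis unfolding \<xi>(2) by (simp add: power_mult_distrib mult_ac)
      qed
      then show "norm (diff 0 (snd z + v * fst z) - (\<Sum>m<n. diff m (snd z) / fact m * (v * fst z) ^ m))
        \<le> \<bar>v\<bar> ^ n * C * norm (fst z ^ n)"
        using h by (simp add: h_def y_def)
    qed
  qed
qed

lemma C_k_on_funpow_deriv_x: "C_k_on (k + m) U f \<Longrightarrow> C_k_on k U ((deriv_x ^^ m) f)"
proof (induction m arbitrary: k)
  case (Suc m)
  then show ?case using C_k_on_deriv_x[of k U "(deriv_x ^^ m) f"] Suc.IH[of "Suc k"] by simp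
qed simp

lemma C_k_on_funpow_deriv_t: "C_k_on (k + m) U f \<Longrightarrow> C_k_on k U ((deriv_t ^^ m) f)"
proof (induction m arbitrary: k)
  case (Suc m)
  then show ?case using C_k_on_deriv_t[of k U "(deriv_t ^^ m) f"] Suc.IH[of "Suc k"] by simp
qed simp

lemma C_k_on_taylor_x:
  assumes "open U" "(x, t) \<in> U" "C_k_on n U f" "n > 0"
  shows "(\<lambda>z. f (snd z + v * fst z) t - (\<Sum>m<n. (deriv_x ^^ m) f (snd z) t / fact m * (v * fst z) ^ m))
    \<in> O[mesh x](\<lambda>z. fst z ^ n)"
proof -
  have reg: "C_k_on (Suc 0) U ((deriv_x ^^ m) f)" if "m < n" for m
    by (rule C_k_on_funpow_deriv_x, rule C_k_on_mono[OF assms(3)]) (use that in auto)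
  have "\<forall>\<^sub>F y in nhds x. \<forall>m<n. ((\<lambda>y. (deriv_x ^^ m) f y t) has_real_derivative (deriv_x ^^ Suc m) f y t) (at y)"
    using eventually_slice_x[OF assms(1,2)]
    by eventually_elim (simp add: C_k_on_has_deriv_x[OF reg])
  moreover have "isCont (\<lambda>y. (deriv_x ^^ n) f y t) x"
    using C_k_on_isCont_x[OF assms(1,2) C_k_on_funpow_deriv_x[of 0 n]] assms(3) by simp
  ultimately show ?thesis
    using taylor_bigo[where n = n and x = x and diff = "\<lambda>m y. (deriv_x ^^ m) f y t"] assms(4) by simp
qed

lemma C_k_on_taylor_t:
  assumes "open U" "(x, t) \<in> U" "C_k_on n U f" "n > 0"
  shows "(\<lambda>k. f x (t + k) - (\<Sum>m<n. (deriv_t ^^ m) f x t / fact m * k ^ m)) \<in> O[at_right 0](\<lambda>k. k ^ n)"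
proof -
  have reg: "C_k_on (Suc 0) U ((deriv_t ^^ m) f)" if "m < n" for m
    by (rule C_k_on_funpow_deriv_t, rule C_k_on_mono[OF assms(3)]) (use that in auto)
  have "\<forall>\<^sub>F s in nhds t. \<forall>m<n. ((\<lambda>s. (deriv_t ^^ m) f x s) has_real_derivative (deriv_t ^^ Suc m) f x s) (at s)"
    using eventually_slice_t[OF assms(1,2)]
    by eventually_elim (simp add: C_k_on_has_deriv_t[OF reg])
  moreover have "isCont (\<lambda>s. (deriv_t ^^ n) f x s) t"
    using C_k_on_isCont_t[OF assms(1,2) C_k_on_funpow_deriv_t[of 0 n]] assms(3) by simp
  ultimately show ?thesis
    using landau_o.big.compose[OF taylor_bigo[where n = n and x = t and diff = "\<lambda>m s. (deriv_t ^^ m) f x s" and v = 1]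
        filterlim_mesh_shift[of t 0]] assms(4) by simp
qed

lemma bigo_divide_factor:
  fixes f s :: "'a \<Rightarrow> real"
  assumes "c \<noteq> 0" "\<forall>\<^sub>F z in F. s z \<noteq> 0" "f \<in> O[F](\<lambda>z. s z ^ Suc p)"
  shows "(\<lambda>z. f z / (c * s z)) \<in> O[F](\<lambda>z. s z ^ p)"
proof -
  obtain C where C: "\<forall>\<^sub>F z in F. norm (f z) \<le> C * norm (s z ^ Suc p)"
    using assms(3) by (auto elim: landau_o.bigE)
  show ?thesis
  proof (rule bigoI[where c = "C / \<bar>c\<bar>"])
    show "\<forall>\<^sub>F z in F. norm (f z / (c * s z)) \<le> C / \<bar>c\<bar> * norm (s z ^ p)"
      using C assms(2)
      by eventually_elim (use assms(1) in \<open>auto simp: field_simps abs_mult\<close>)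
  qed
qed

lemma bigo_cmult: "f \<in> O[F](g) \<Longrightarrow> (\<lambda>z. c * f z) \<in> O[F](g)" for c :: real
  by simp

text \<open>
  Even powers cancel in the difference of the Taylor expansions at \<open>y \<plusminus> w h\<close>. Central differences commute
  with \<open>\<partial>\<^sub>x\<close>, so the derivative of the error is the error for \<open>f\<^sub>x\<close>, which allows induction
  on the number of derivatives.
\<close>

lemma cdiff_consistent:
  assumes "open U" "(x, t) \<in> U" "w > 0" "C_k_on (m + 3) U f"
  shows "small x 2 m (\<lambda>h y. cdiff w (\<lambda>_ y. f y t) h y - deriv_x f y t)"
proof -
  have base: "(\<lambda>z. cdiff w (\<lambda>_ y. f y t) (fst z) (snd z) - deriv_x f (snd z) t) \<in> O[mesh x](\<lambda>z. fst z ^ 2)"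
    if "C_k_on 3 U f" for f
  proof -
    define R where "R v z = f (snd z + v * fst z) t - (\<Sum>m<3. (deriv_x ^^ m) f (snd z) t / fact m * (v * fst z) ^ m)" for v z
    have "(\<lambda>z. R v z) \<in> O[mesh x](\<lambda>z. fst z ^ 3)" for v
      unfolding R_def by (rule C_k_on_taylor_x[OF assms(1,2) that]) simp
    then have "(\<lambda>z. R w z - R (- w) z) \<in> O[mesh x](\<lambda>z. fst z ^ 3)"
      by (intro sum_in_bigo)
    then have "(\<lambda>z. (R w z - R (- w) z) / ((2 * w) * fst z)) \<in> O[mesh x](\<lambda>z. fst z ^ 2)"
      using assms(3) eventually_mono[OF eventually_mesh_step_pos[of x]]
      by (intro bigo_divide_factor) (auto simp: numeral_eq_Suc)
    moreover have "\<forall>\<^sub>F z in mesh x. (R w z - R (- w) z) / ((2 * w) * fst z)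
        = cdiff w (\<lambda>_ y. f y t) (fst z) (snd z) - deriv_x f (snd z) t"
      using eventually_mesh_step_pos[of x]
      by eventually_elim
        (use assms(3) in \<open>simp add: R_def cdiff_def numeral_3_eq_3 lessThan_Suc field_simps\<close>)
    ultimately show ?thesis by (rule landau_o.big.in_cong[THEN iffD1, rotated])
  qed
  show ?thesis
    using assms(4)
  proof (induction m arbitrary: f)
    case 0
    then show ?case using base[of f] by simp
  next
    case (Suc m)
    have f: "C_k_on (Suc (m + 3)) U f" using Suc.prems by simp
    show ?case
    proof (rule small_SucI)
      show "(\<lambda>z. cdiff w (\<lambda>_ y. f y t) (fst z) (snd z) - deriv_x f (snd z) t) \<in> O[mesh x](\<lambda>z. fst z ^ 2)"
        by (rule base, rule C_k_on_mono[OF f]) simp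
      have "\<forall>\<^sub>F z in mesh x. ((\<lambda>y. f y t) has_real_derivative deriv_x f (snd z) t) (at (snd z))"
        by (rule eventually_mesh_snd, rule eventually_mono[OF eventually_slice_x[OF assms(1,2)]])
           (rule C_k_on_has_deriv_x[OF f])
      from cdiff_has_derivative[OF assms(3), where e = "\<lambda>_ y. f y t" and e' = "\<lambda>_ y. deriv_x f y t", OF this]
      have "\<forall>\<^sub>F z in mesh x. (cdiff w (\<lambda>_ y. f y t) (fst z) has_real_derivative
          cdiff w (\<lambda>_ y. deriv_x f y t) (fst z) (snd z)) (at (snd z))" .
      moreover have "\<forall>\<^sub>F z in mesh x. ((\<lambda>y. deriv_x f y t) has_real_derivative deriv_x (deriv_x f) (snd z) t) (at (snd z))"
        by (rule eventually_mesh_snd, rule eventually_mono[OF eventually_slice_x[OF assms(1,2)]])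
           (rule C_k_on_has_deriv_x[of "m + 2"], use C_k_on_deriv_x[OF f] in \<open>simp_all add: numeral_eq_Suc\<close>)
      ultimately show "\<forall>\<^sub>F z in mesh x. ((\<lambda>y. cdiff w (\<lambda>_ y. f y t) (fst z) y - deriv_x f y t) has_real_derivative
          cdiff w (\<lambda>_ y. deriv_x f y t) (fst z) (snd z) - deriv_x (deriv_x f) (snd z) t) (at (snd z))"
        by eventually_elim (rule DERIV_diff)
      show "small x 2 m (\<lambda>h y. cdiff w (\<lambda>_ y. deriv_x f y t) h y - deriv_x (deriv_x f) y t)"
        by (rule Suc.IH[OF C_k_on_deriv_x[OF f]])
    qed
  qed
qed

section \<open>Second-order approximation\<close>

text \<open>
  The notion of consistency that is stable under the operations of the scheme: \<open>e\<close> approximates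
  \<open>f(\<cdot>, t)\<close> to second order in \<open>C\<^sup>m\<close> near \<open>x\<close>.
\<close>

definition approx :: "real \<Rightarrow> real \<Rightarrow> nat \<Rightarrow> (real \<Rightarrow> real \<Rightarrow> real) \<Rightarrow> (real \<Rightarrow> real \<Rightarrow> real) \<Rightarrow> bool" where
  "approx x t m e f \<longleftrightarrow> small x 2 m (\<lambda>h y. e h y - f y t)"

lemma approx_refl: "approx x t m (\<lambda>_ y. f y t) f"
proof -
  have "small x 2 m (\<lambda>_ _. 0)"
    by (induction m) (auto intro!: exI[of _ "\<lambda>_ _. 0"])
  then show ?thesis by (simp add: approx_def)
qed

lemma approx_Suc_imp: "approx x t (Suc m) e f \<Longrightarrow> approx x t m e f"
  unfolding approx_def by (rule small_Suc_imp)

lemma approx_mono: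
  assumes "approx x t n e f" "m \<le> n"
  shows "approx x t m e f"
  using assms(2,1) by (induction rule: dec_induct) (auto dest: approx_Suc_imp)

lemma approx_mult:
  assumes "open U" "(x, t) \<in> U" "C_k_on m U f" "C_k_on m U g"
    and e: "approx x t m e f" and d: "approx x t m d g"
  shows "approx x t m (\<lambda>h y. e h y * d h y) (\<lambda>y s. f y s * g y s)"
proof -
  have "small x 0 m (\<lambda>h y. (e h y - f y t) + f y t)"
    by (rule small_add[OF small_weaken[OF e[unfolded approx_def]] small_of_C_k_on[OF assms(1-3)]]) simp
  then have "small x (0 + 2) m (\<lambda>h y. e h y * (d h y - g y t))"
    by (intro small_mult d[unfolded approx_def]) simp
  moreover have "small x (2 + 0) m (\<lambda>h y. (e h y - f y t) * g y t)"
    by (intro small_mult e[unfolded approx_def] small_of_C_k_on[OF assms(1,2,4)])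
  ultimately have "small x 2 m (\<lambda>h y. e h y * (d h y - g y t) + (e h y - f y t) * g y t)"
    by (simp only: add_0_left add_0_right small_add)
  then show ?thesis unfolding approx_def by (simp add: algebra_simps)
qed

text \<open>
  The error splits into the central difference of the error of \<open>e\<close> (\<open>small_cdiff\<close>) and the error of
  the central difference of \<open>f\<close> itself (\<open>cdiff_consistent\<close>).
\<close>

lemma approx_cdiff:
  assumes "open U" "(x, t) \<in> U" "w > 0" "C_k_on (m + 3) U f" "approx x t (Suc m) e f"
  shows "approx x t m (cdiff w e) (deriv_x f)"
proof -
  have "cdiff w (\<lambda>h y. e h y - f y t) = (\<lambda>h y. cdiff w e h y - cdiff w (\<lambda>_ y. f y t) h y)"
    by (intro ext) (simp add: cdiff_def diff_divide_distrib)
  then have "small x 2 m (\<lambda>h y. cdiff w e h y - cdiff w (\<lambda>_ y. f y t) h y)"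
    using small_cdiff[OF assms(3) assms(5)[unfolded approx_def]] by simp
  from small_add[OF this cdiff_consistent[OF assms(1-4)]]
  show ?thesis by (simp add: approx_def)
qed

lemma approx_at:
  assumes "approx x t m e f"
  shows "(\<lambda>h. e h (x + v * h) - f (x + v * h) t) \<in> O[at_right 0](\<lambda>h. h\<^sup>2)"
  using landau_o.big.compose[OF small_imp_bigo[OF assms[unfolded approx_def]] filterlim_mesh_shift[of x v]] by simp

lemma power_bigo_mono_at_right:
  assumes "p \<le> q"
  shows "(\<lambda>h. h ^ q) \<in> O[at_right 0](\<lambda>h. h ^ p :: real)"
  using landau_o.big.compose[OF step_power_bigo_mono[OF assms, of 0] filterlim_mesh_shift[of 0 0]] by simp

text \<open>
  The form in which the truncation error is estimated. The remainders depend on one step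
  only, so the two steps may tend to \<open>0\<close> independently.
\<close>

lemma second_orderI:
  assumes r: "r \<in> O[at_right 0](\<lambda>k. k\<^sup>2)" and e1: "e1 \<in> O[at_right 0](\<lambda>h. h\<^sup>2)"
    and e2: "e2 \<in> O[at_right 0](\<lambda>h. h)" and e3: "e3 \<in> O[at_right 0](\<lambda>_. 1)"
    and eq: "\<And>h k. 0 < h \<Longrightarrow> 0 < k \<Longrightarrow> \<tau> h k = r k + e1 h + k * e2 h + k\<^sup>2 * e3 h"
  shows "second_order \<tau>"
proof -
  obtain Cr where Cr: "\<forall>\<^sub>F k in at_right 0. norm (r k) \<le> Cr * norm (k\<^sup>2)" "Cr > 0"
    using r by (auto elim: landau_o.bigE)
  obtain C1 where C1: "\<forall>\<^sub>F h in at_right 0. norm (e1 h) \<le> C1 * norm (h\<^sup>2)" "C1 > 0"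
    using e1 by (auto elim: landau_o.bigE)
  obtain C2 where C2: "\<forall>\<^sub>F h in at_right 0. norm (e2 h) \<le> C2 * norm h" "C2 > 0"
    using e2 by (auto elim: landau_o.bigE)
  obtain C3 where C3: "\<forall>\<^sub>F h in at_right 0. norm (e3 h) \<le> C3 * norm (1 :: real)" "C3 > 0"
    using e3 by (auto elim: landau_o.bigE)
  have pos: "\<forall>\<^sub>F h in at_right 0. 0 < (h :: real)" by (rule eventually_at_right_less)
  define C where "C = Cr + C1 + C2 + C3"
  have bound: "\<bar>\<tau> h k\<bar> \<le> C * \<bar>k\<^sup>2 + h\<^sup>2 + h * k\<bar>"
    if "0 < h" "\<bar>e1 h\<bar> \<le> C1 * h\<^sup>2" "\<bar>e2 h\<bar> \<le> C2 * h" "\<bar>e3 h\<bar> \<le> C3" "0 < k" "\<bar>r k\<bar> \<le> Cr * k\<^sup>2" for h k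
  proof -
    have "\<bar>\<tau> h k\<bar> \<le> \<bar>r k\<bar> + \<bar>e1 h\<bar> + \<bar>k * e2 h\<bar> + \<bar>k\<^sup>2 * e3 h\<bar>"
      using eq[OF that(1,5)] by linarith
    also have "\<bar>k * e2 h\<bar> \<le> k * (C2 * h)"
      using that by (simp add: abs_mult)
    also have "\<bar>k\<^sup>2 * e3 h\<bar> \<le> k\<^sup>2 * C3"
      using that by (simp add: abs_mult mult_left_mono)
    finally have "\<bar>\<tau> h k\<bar> \<le> (Cr + C3) * k\<^sup>2 + C1 * h\<^sup>2 + C2 * (h * k)"
      using that by (simp add: algebra_simps)
    also have "\<dots> \<le> C * k\<^sup>2 + C * h\<^sup>2 + C * (h * k)"
      using that Cr(2) C1(2) C2(2) C3(2) by (intro add_mono mult_right_mono) (auto simp: C_def)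
    also have "\<dots> = C * \<bar>k\<^sup>2 + h\<^sup>2 + h * k\<bar>"
      using that by (simp add: algebra_simps)
    finally show ?thesis .
  qed
  have A: "\<forall>\<^sub>F h in at_right 0. 0 < h \<and> \<bar>e1 h\<bar> \<le> C1 * h\<^sup>2 \<and> \<bar>e2 h\<bar> \<le> C2 * h \<and> \<bar>e3 h\<bar> \<le> C3"
    using pos C1(1) C2(1) C3(1) by eventually_elim simp
  have B: "\<forall>\<^sub>F k in at_right 0. 0 < k \<and> \<bar>r k\<bar> \<le> Cr * k\<^sup>2"
    using pos Cr(1) by eventually_elim simp
  have "\<forall>\<^sub>F z in at_right 0 \<times>\<^sub>F at_right 0. norm (case z of (h, k) \<Rightarrow> \<tau> h k)
      \<le> C * norm (case z of (h, k) \<Rightarrow> k\<^sup>2 + h\<^sup>2 + h * k)"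
    unfolding eventually_prod_filter
    by (rule exI, rule exI, rule conjI[OF A], rule conjI[OF B]) (use bound in auto)
  then show ?thesis unfolding second_order_def by (rule bigoI)
qed

section \<open>The schemes in terms of central differences\<close>

lemma cdiff_at: "cdiff w e h (x + j * h) = (e h (x + (j + w) * h) - e h (x + (j - w) * h)) / (2 * w * h)"
  by (simp add: cdiff_def algebra_simps)

text \<open>
  The second scheme is what the first becomes when all coefficients are equal and their time
  derivatives vanish. With \<open>1 / 0 = 0\<close> this holds for \<open>h = 0\<close> as well, since the identity is
  polynomial in \<open>1 / h\<close>.
\<close>

lemma scheme2_eq_scheme1: "scheme2 \<alpha> lam \<beta> h k = scheme1 (\<lambda>_ _. \<alpha>) lam \<beta> x t h k"
proof (intro ext)
  fix qm2 qm1 q0 qp1 qp2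
  define i where "i = inverse h"
  have i: "y / h = y * i" "y / h\<^sup>2 = y * i\<^sup>2" "y / (2 * h\<^sup>2) = y / 2 * i\<^sup>2" for y
    by (simp_all add: i_def field_simps)
  show "scheme2 \<alpha> lam \<beta> h k qm2 qm1 q0 qp1 qp2 = scheme1 (\<lambda>_ _. \<alpha>) lam \<beta> x t h k qm2 qm1 q0 qp1 qp2"
    unfolding scheme1_def scheme2_def Let_def deriv_t_def i deriv_const mult_zero_right add_0_right
    by algebra
qed

lemma scheme3_eq_scheme2: "scheme3 lam \<beta> h k = scheme2 0 lam \<beta> h k"
  unfolding scheme3_def scheme2_def Let_def fun_eq_iff by simp

definition gradient :: "(real \<Rightarrow> real \<Rightarrow> real) \<Rightarrow> real \<Rightarrow> real \<Rightarrow> real \<Rightarrow> real" where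
  "gradient q t = cdiff (1/2) (\<lambda>_ y. q y t)"

definition wide_gradient :: "(real \<Rightarrow> real \<Rightarrow> real) \<Rightarrow> real \<Rightarrow> real \<Rightarrow> real \<Rightarrow> real" where
  "wide_gradient q t = cdiff 1 (\<lambda>_ y. q y t)"

text \<open>
  A second difference with weights \<open>1, -1, -1, 1\<close> on four equidistant points. This is the slope
  \<open>q\<^sub>i\<^sub>+\<^sub>1 - q\<^sub>i - q\<^sub>i\<^sub>-\<^sub>1 + q\<^sub>i\<^sub>-\<^sub>2\<close> occurring in the schemes, centred at \<open>x\<^sub>i - h / 2\<close>, divided by \<open>2 h\<^sup>2\<close>.
\<close>

definition wide_laplacian :: "(real \<Rightarrow> real \<Rightarrow> real) \<Rightarrow> real \<Rightarrow> real \<Rightarrow> real \<Rightarrow> real" where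
  "wide_laplacian q t = cdiff (1/2) (wide_gradient q t)"

definition divergence ::
    "(real \<Rightarrow> real \<Rightarrow> real) \<Rightarrow> real \<Rightarrow> (real \<Rightarrow> real \<Rightarrow> real) \<Rightarrow> real \<Rightarrow> real \<Rightarrow> real" where
  "divergence \<alpha> t e = cdiff (1/2) (\<lambda>h y. \<alpha> y t * e h y)"

text \<open>
  Discretises \<open>(\<alpha> q\<^sub>x)\<^sub>x\<^sub>x\<close>: the bracket of the scheme with weights \<open>1, -2, 1\<close> on neighbouring fluxes.
\<close>

definition diffusion_slope ::
    "(real \<Rightarrow> real \<Rightarrow> real) \<Rightarrow> (real \<Rightarrow> real \<Rightarrow> real) \<Rightarrow> real \<Rightarrow> real \<Rightarrow> real \<Rightarrow> real" where
  "diffusion_slope \<alpha> q t = cdiff (1/2) (divergence \<alpha> t (gradient q t))"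

text \<open>
  Up to a factor \<open>h\<close>, the upwind difference \<open>q\<^sub>i - q\<^sub>i\<^sub>-\<^sub>1\<close> plus a quarter of the slope
  \<open>q\<^sub>i\<^sub>+\<^sub>1 - q\<^sub>i - q\<^sub>i\<^sub>-\<^sub>1 + q\<^sub>i\<^sub>-\<^sub>2\<close>, both centred at \<open>x - h / 2\<close>.
\<close>

definition upwind_gradient :: "(real \<Rightarrow> real \<Rightarrow> real) \<Rightarrow> real \<Rightarrow> real \<Rightarrow> real \<Rightarrow> real" where
  "upwind_gradient q x t h = gradient q t h (x + -1/2 * h) + h / 2 * wide_laplacian q t h (x + -1/2 * h)"

text \<open>
  The coefficients of \<open>k\<close>, \<open>k\<^sup>2 / 2\<close> and \<open>k\<^sup>3 / 4\<close> in the scheme. Points are written \<open>x + j * h\<close> throughout,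
  also for \<open>j = 0\<close>, so that a single rule evaluates every difference.
\<close>

definition rate1 ::
    "(real \<Rightarrow> real \<Rightarrow> real) \<Rightarrow> real \<Rightarrow> real \<Rightarrow> (real \<Rightarrow> real \<Rightarrow> real) \<Rightarrow> real \<Rightarrow> real \<Rightarrow> real \<Rightarrow> real" where
  "rate1 \<alpha> lam \<beta> q x t h =
     - lam * upwind_gradient q x t h + divergence \<alpha> t (gradient q t) h (x + 0 * h) + \<beta> * q x t"

definition rate2 ::
    "(real \<Rightarrow> real \<Rightarrow> real) \<Rightarrow> real \<Rightarrow> real \<Rightarrow> (real \<Rightarrow> real \<Rightarrow> real) \<Rightarrow> real \<Rightarrow> real \<Rightarrow> real \<Rightarrow> real" where
  "rate2 \<alpha> lam \<beta> q x t h =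
     - lam * \<beta> * upwind_gradient q x t h
     + lam\<^sup>2 * wide_laplacian q t h (x + -1/2 * h)
     - lam * diffusion_slope \<alpha> q t h (x + -1/2 * h)
     + divergence (deriv_t \<alpha>) t (gradient q t) h (x + 0 * h)
     - lam * divergence \<alpha> t (wide_laplacian q t) h (x + 0 * h)
     + divergence \<alpha> t (diffusion_slope \<alpha> q t) h (x + 0 * h)
     + 2 * \<beta> * divergence \<alpha> t (gradient q t) h (x + 0 * h)
     - lam * \<beta> * wide_gradient q t h (x + 0 * h)
     + \<beta>\<^sup>2 * q x t"

definition rate3 ::
    "(real \<Rightarrow> real \<Rightarrow> real) \<Rightarrow> real \<Rightarrow> real \<Rightarrow> (real \<Rightarrow> real \<Rightarrow> real) \<Rightarrow> real \<Rightarrow> real \<Rightarrow> real \<Rightarrow> real" where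
  "rate3 \<alpha> lam \<beta> q x t h =
     \<beta> * divergence (deriv_t \<alpha>) t (gradient q t) h (x + 0 * h)
     - lam * divergence (deriv_t \<alpha>) t (wide_laplacian q t) h (x + 0 * h)
     + divergence (deriv_t \<alpha>) t (diffusion_slope \<alpha> q t) h (x + 0 * h)"

text \<open>
  Both sides are polynomials in \<open>k\<close> and \<open>1 / h\<close>. They are compared after rewriting every
  difference in terms of the jumps of \<open>q\<close> and of the flux at the two interfaces of the cell.
\<close>

lemma scheme1_expansion:
  assumes "0 < h"
  shows "scheme1 \<alpha> lam \<beta> x t h k (q (x - 2 * h) t) (q (x - h) t) (q x t) (q (x + h) t) (q (x + 2 * h) t)
    = q x t + k * (rate1 \<alpha> lam \<beta> q x t h + k / 2 * rate2 \<alpha> lam \<beta> q x t h + k\<^sup>2 / 4 * rate3 \<alpha> lam \<beta> q x t h)"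
proof -
  define g A B where "g j = q (x + j * h) t" and "A j = \<alpha> (x + j * h) t" and "B j = deriv_t \<alpha> (x + j * h) t" for j
  define i where "i = inverse h"
  have i: "y / h = y * i" "y / h\<^sup>2 = y * i\<^sup>2" "y / (2 * h\<^sup>2) = y / 2 * i\<^sup>2" "y / (2 * h) = y / 2 * i" for y
    by (simp_all add: i_def field_simps)
  have half: "cdiff (1/2) e h (x + j * h) = (e h (x + (j + 1/2) * h) - e h (x + (j - 1/2) * h)) * i" for e j
    unfolding cdiff_at by (simp add: i(1))
  have grad: "gradient q t h (x + j * h) = (g (j + 1/2) - g (j - 1/2)) * i" for j
    unfolding gradient_def half g_def ..
  have wgrad: "wide_gradient q t h (x + j * h) = (g (j + 1) - g (j - 1)) / 2 * i" for j
    unfolding wide_gradient_def cdiff_at g_def by (simp add: i(4))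
  have div: "divergence \<alpha> t e h (x + j * h)
      = (A (j + 1/2) * e h (x + (j + 1/2) * h) - A (j - 1/2) * e h (x + (j - 1/2) * h)) * i" for e j
    unfolding divergence_def half A_def ..
  have div': "divergence (deriv_t \<alpha>) t e h (x + j * h)
      = (B (j + 1/2) * e h (x + (j + 1/2) * h) - B (j - 1/2) * e h (x + (j - 1/2) * h)) * i" for e j
    unfolding divergence_def half B_def ..
  have g: "q (x - 2 * h) t = g (-2)" "q (x - h) t = g (-1)" "q x t = g 0" "q (x + h) t = g 1" "q (x + 2 * h) t = g 2"
    by (simp_all add: g_def)
  \<comment> \<open>Jumps of \<open>q\<close> across the right and left interface (\<open>P\<close>, \<open>M\<close>), slopes centred there (\<open>E'\<close>, \<open>E\<close>),
    and second differences of the flux (\<open>w'\<close>, \<open>w\<close>).\<close>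
  define P M E E' N w w' where "P = g 1 - g 0" and "M = g 0 - g (-1)"
    and "E = P - g (-1) + g (-2)" and "E' = g 2 - g 1 - g 0 + g (-1)" and "N = g 1 - g (-1)"
    and "w = A (1/2) * P - 2 * A (-1/2) * M + A (-3/2) * (g (-1) - g (-2))"
    and "w' = A (3/2) * (g 2 - g 1) - 2 * A (1/2) * P + A (-1/2) * M"
  note differences = P_def M_def E_def E'_def N_def w_def w'_def
  have grads: "gradient q t h (x + (0 + 1/2) * h) = P * i" "gradient q t h (x + (0 - 1/2) * h) = M * i"
    unfolding grad differences by simp_all
  have laps: "wide_laplacian q t h (x + (0 + 1/2) * h) = E' / 2 * i\<^sup>2"
    "wide_laplacian q t h (x + (0 - 1/2) * h) = E / 2 * i\<^sup>2"
    "wide_laplacian q t h (x + -1/2 * h) = E / 2 * i\<^sup>2"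
    unfolding wide_laplacian_def half wgrad differences by (simp_all add: field_simps power2_eq_square)
  have slopes: "diffusion_slope \<alpha> q t h (x + (0 + 1/2) * h) = w' * i * i\<^sup>2"
    "diffusion_slope \<alpha> q t h (x + (0 - 1/2) * h) = w * i * i\<^sup>2"
    "diffusion_slope \<alpha> q t h (x + -1/2 * h) = w * i * i\<^sup>2"
    unfolding diffusion_slope_def half div grad differences by (simp_all add: field_simps power2_eq_square)
  have up: "upwind_gradient q x t h = M * i + E / 4 * i"
    unfolding upwind_gradient_def laps grad differences using assms
    by (simp add: i_def field_simps power2_eq_square)
  have wide: "wide_gradient q t h (x + 0 * h) = N / 2 * i"
    unfolding wgrad differences by simp
  have coeffs: "A (0 + 1/2) = A (1/2)" "A (0 - 1/2) = A (-1/2)" "B (0 + 1/2) = B (1/2)" "B (0 - 1/2) = B (-1/2)"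
    by simp_all
  have neg: "g (-1) - g 0 = - M" "g 0 - g (-2) - g 1 + g (-1) = - E"
    "2 * A (-1/2) * M - A (-3/2) * (g (-1) - g (-2)) - A (1/2) * P = - w"
    by (simp_all add: differences)
  show ?thesis
    unfolding scheme1_def Let_def rate1_def rate2_def rate3_def up div div'
    unfolding coeffs grads laps slopes wide g A_def[symmetric] B_def[symmetric] i
    unfolding P_def[symmetric] M_def[symmetric] E_def[symmetric] E'_def[symmetric] N_def[symmetric] neg
    unfolding w_def[symmetric] w'_def[symmetric] neg
    by (simp add: field_simps power2_eq_square)
qed

section \<open>Consistency of the difference operators\<close>

lemma approx_divergence:
  assumes "open U" "(x, t) \<in> U" "C_k_on (m + 3) U \<alpha>" "C_k_on (m + 3) U f" "approx x t (Suc m) e f"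
  shows "approx x t m (divergence \<alpha> t e) (deriv_x (\<lambda>y s. \<alpha> y s * f y s))"
proof -
  have product: "approx x t (Suc m) (\<lambda>h y. \<alpha> y t * e h y) (\<lambda>y s. \<alpha> y s * f y s)"
    by (rule approx_mult[OF assms(1,2) _ _ approx_refl assms(5)]) (rule C_k_on_mono, rule assms, simp)+
  show ?thesis
    unfolding divergence_def
    by (rule approx_cdiff[OF assms(1,2) _ C_k_on_mult[OF assms(1,3,4)] product]) simp
qed

text \<open>
  Evaluating off centre moves the argument by a multiple of \<open>h\<close>, which costs one order.
\<close>

lemma approx_bigo_step:
  assumes "open U" "(x, t) \<in> U" "approx x t m e f" "C_k_on (Suc n) U f"
  shows "(\<lambda>h. e h (x + v * h) - f x t) \<in> O[at_right 0](\<lambda>h. h)"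
proof -
  have "(\<lambda>h. f (x + v * h) t - f x t) \<in> O[at_right 0](\<lambda>h. h)"
    using landau_o.big.compose[OF C_k_on_taylor_x[OF assms(1,2) C_k_on_mono[OF assms(4)], of 1 v] filterlim_mesh_shift[of x 0]]
    by simp
  moreover have "(\<lambda>h. e h (x + v * h) - f (x + v * h) t) \<in> O[at_right 0](\<lambda>h. h)"
    using landau_o.big_trans[OF approx_at[OF assms(3)] power_bigo_mono_at_right[of 1 2]] by simp
  ultimately have "(\<lambda>h. (e h (x + v * h) - f (x + v * h) t) + (f (x + v * h) t - f x t)) \<in> O[at_right 0](\<lambda>h. h)"
    by (rule sum_in_bigo(1)[rotated])
  then show ?thesis by simp
qed

lemma bounded_of_bigo_step:
  assumes "(\<lambda>h. e h - c) \<in> O[at_right 0](\<lambda>h. h)"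
  shows "e \<in> O[at_right 0](\<lambda>_. 1 :: real)"
proof -
  have "(\<lambda>h. e h - c) \<in> O[at_right 0](\<lambda>_. 1)"
    using landau_o.big_trans[OF assms] power_bigo_mono_at_right[of 0 1] by simp
  moreover have "(\<lambda>_. c) \<in> O[at_right 0](\<lambda>_. 1)"
    by simp
  ultimately have "(\<lambda>h. (e h - c) + c) \<in> O[at_right 0](\<lambda>_. 1)"
    by (rule sum_in_bigo(1))
  then show ?thesis by simp
qed

lemma approx_gradient:
  assumes "open U" "(x, t) \<in> U" "C_k_on (m + 3) U q"
  shows "approx x t m (gradient q t) (deriv_x q)"
  unfolding gradient_def by (intro approx_cdiff[OF assms(1,2) _ assms(3)] approx_refl) simp

lemma approx_wide_gradient:
  assumes "open U" "(x, t) \<in> U" "C_k_on (m + 3) U q"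
  shows "approx x t m (wide_gradient q t) (deriv_x q)"
  unfolding wide_gradient_def by (intro approx_cdiff[OF assms(1,2) _ assms(3)] approx_refl) simp

lemma approx_wide_laplacian:
  assumes "open U" "(x, t) \<in> U" "C_k_on (m + 4) U q"
  shows "approx x t m (wide_laplacian q t) (deriv_x (deriv_x q))"
  unfolding wide_laplacian_def
proof (rule approx_cdiff[OF assms(1,2)])
  show "C_k_on (m + 3) U (deriv_x q)"
    by (rule C_k_on_deriv_x) (use assms(3) in \<open>simp add: numeral_eq_Suc\<close>)
  show "approx x t (Suc m) (wide_gradient q t) (deriv_x q)"
    by (rule approx_wide_gradient[OF assms(1,2)]) (use assms(3) in \<open>simp add: numeral_eq_Suc\<close>)
qed simp

text \<open>
  At the interface \<open>x - h / 2\<close> the two terms are \<open>q\<^sub>x\<close> and \<open>(h / 2) q\<^sub>x\<^sub>x\<close> up to \<open>O(h\<^sup>2)\<close>, and their sum is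
  the first-order Taylor polynomial of \<open>q\<^sub>x\<close>, based there and evaluated at \<open>x\<close>.
\<close>

lemma upwind_gradient_consistent:
  assumes "open U" "(x, t) \<in> U" "C_k_on 4 U q"
  shows "(\<lambda>h. upwind_gradient q x t h - deriv_x q x t) \<in> O[at_right 0](\<lambda>h. h\<^sup>2)"
proof -
  define r1 where "r1 h = gradient q t h (x + -1/2 * h) - deriv_x q (x + -1/2 * h) t" for h
  define r2 where "r2 h = wide_laplacian q t h (x + -1/2 * h) - deriv_x (deriv_x q) (x + -1/2 * h) t" for h
  define r3 where "r3 h = deriv_x q (x + -1/2 * h + 1/2 * h) t
    - (\<Sum>m<2. (deriv_x ^^ m) (deriv_x q) (x + -1/2 * h) t / fact m * (1/2 * h) ^ m)" for h
  have "C_k_on 3 U q" by (rule C_k_on_mono[OF assms(3)]) simp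
  then have "r1 \<in> O[at_right 0](\<lambda>h. h\<^sup>2)"
    unfolding r1_def by (intro approx_at[OF approx_gradient[OF assms(1,2), of 0]]) simp
  moreover have "r2 \<in> O[at_right 0](\<lambda>h. h\<^sup>2)"
    unfolding r2_def by (intro approx_at[OF approx_wide_laplacian[OF assms(1,2), of 0]]) (use assms(3) in simp)
  then have "(\<lambda>h. h * r2 h) \<in> O[at_right 0](\<lambda>h. h ^ 3)"
    using landau_o.big.mult[of "\<lambda>h. h" "at_right 0" "\<lambda>h. h" r2 "\<lambda>h. h\<^sup>2"] by (simp add: numeral_eq_Suc)
  then have "(\<lambda>h. h * r2 h) \<in> O[at_right 0](\<lambda>h. h\<^sup>2)"
    by (rule landau_o.big_trans) (rule power_bigo_mono_at_right, simp)
  then have "(\<lambda>h. 1/2 * (h * r2 h)) \<in> O[at_right 0](\<lambda>h. h\<^sup>2)"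
    by (rule bigo_cmult)
  moreover have "r3 \<in> O[at_right 0](\<lambda>h. h\<^sup>2)"
  proof -
    have "C_k_on 2 U (deriv_x q)"
      by (rule C_k_on_deriv_x, rule C_k_on_mono[OF assms(3)]) simp
    from landau_o.big.compose[OF C_k_on_taylor_x[OF assms(1,2) this, of "1/2"] filterlim_mesh_shift[of x "-1/2"]]
    show ?thesis unfolding r3_def by simp
  qed
  ultimately have "(\<lambda>h. r1 h + 1/2 * (h * r2 h) - r3 h) \<in> O[at_right 0](\<lambda>h. h\<^sup>2)"
    by (intro sum_in_bigo)
  moreover have "r1 h + 1/2 * (h * r2 h) - r3 h = upwind_gradient q x t h - deriv_x q x t" for h
    by (simp add: r1_def r2_def r3_def upwind_gradient_def numeral_2_eq_2 lessThan_Suc algebra_simps)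
  ultimately show ?thesis by simp
qed

section \<open>Solutions and their time derivatives\<close>

context
  fixes U :: "(real \<times> real) set" and \<alpha> q :: "real \<Rightarrow> real \<Rightarrow> real" and lam \<beta> :: real
  assumes openU: "open U" and C_q: "C_k_on 6 U q" and C_\<alpha>: "C_k_on 6 U \<alpha>"
    and sol: "solves_adv_diff_reac \<alpha> lam \<beta> U q"
begin

abbreviation (input) "flux \<equiv> \<lambda>y s. \<alpha> y s * deriv_x q y s"

lemma C_q_x: "C_k_on 5 U (deriv_x q)" and C_\<alpha>_t: "C_k_on 5 U (deriv_t \<alpha>)"
  using C_q C_\<alpha> by (simp_all add: numeral_eq_Suc)

lemma C_q_xx: "C_k_on 4 U (deriv_x (deriv_x q))"
  using C_q_x by (simp_all add: numeral_eq_Suc)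

lemma C5_\<alpha>: "C_k_on 5 U \<alpha>"
  by (rule C_k_on_mono[OF C_\<alpha>]) simp

lemma C_flux: "C_k_on 5 U flux"
  by (rule C_k_on_mult[OF openU C5_\<alpha> C_q_x])

lemma C_flux_x: "C_k_on 4 U (deriv_x flux)"
  using C_flux by (simp_all add: numeral_eq_Suc)

lemma C_flux_xx: "C_k_on 3 U (deriv_x (deriv_x flux))"
  using C_flux_x by (simp add: numeral_eq_Suc)

lemma has_deriv_x_numeral: "C_k_on (numeral n) U f \<Longrightarrow> (y, s) \<in> U \<Longrightarrow> ((\<lambda>y. f y s) has_real_derivative deriv_x f y s) (at y)"
  and has_deriv_t_numeral: "C_k_on (numeral n) U f \<Longrightarrow> (y, s) \<in> U \<Longrightarrow> ((\<lambda>s. f y s) has_real_derivative deriv_t f y s) (at s)"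
  by (rule C_k_on_has_deriv_x[of "pred_numeral n"], simp_all add: numeral_eq_Suc,
      rule C_k_on_has_deriv_t[of "pred_numeral n"], simp_all add: numeral_eq_Suc)

lemma evolution:
  assumes "(y, s) \<in> U"
  shows "deriv_t q y s = - lam * deriv_x q y s + deriv_x flux y s + \<beta> * q y s"
  using sol assms unfolding solves_adv_diff_reac_def by fastforce

lemma evolution_deriv_x:
  assumes "(y, s) \<in> U"
  shows "deriv_t (deriv_x q) y s
    = - lam * deriv_x (deriv_x q) y s + deriv_x (deriv_x flux) y s + \<beta> * deriv_x q y s"
proof -
  have "deriv_t (deriv_x q) y s = deriv_x (deriv_t q) y s"
    by (rule deriv_t_deriv_x_commute[OF openU assms C_k_on_mono[OF C_q]]) simp
  also have "\<dots> = deriv_x (\<lambda>y s. - lam * deriv_x q y s + deriv_x flux y s + \<beta> * q y s) y s"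
    by (rule deriv_x_cong[OF openU evolution assms])
  also have "\<dots> = - lam * deriv_x (deriv_x q) y s + deriv_x (deriv_x flux) y s + \<beta> * deriv_x q y s"
    unfolding deriv_x_def[of "\<lambda>y s. - lam * deriv_x q y s + deriv_x flux y s + \<beta> * q y s"]
    by (rule DERIV_imp_deriv, intro DERIV_add DERIV_cmult has_deriv_x_numeral[OF C_q_x] has_deriv_x_numeral[OF C_flux_x] has_deriv_x_numeral[OF C_q] assms)
  finally show ?thesis .
qed

lemma flux_deriv_t:
  assumes "(y, s) \<in> U"
  shows "deriv_t flux y s = deriv_t \<alpha> y s * deriv_x q y s - lam * (\<alpha> y s * deriv_x (deriv_x q) y s)
    + \<alpha> y s * deriv_x (deriv_x flux) y s + \<beta> * flux y s"
proof -
  have "deriv_t flux y s = deriv_t \<alpha> y s * deriv_x q y s + deriv_t (deriv_x q) y s * \<alpha> y s"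
    unfolding deriv_t_def[of flux]
    by (rule DERIV_imp_deriv, intro DERIV_mult has_deriv_t_numeral[OF C_\<alpha>] has_deriv_t_numeral[OF C_q_x] assms)
  then show ?thesis by (simp add: evolution_deriv_x[OF assms] algebra_simps)
qed

lemma flux_deriv_x_deriv_t:
  assumes "(y, s) \<in> U"
  shows "deriv_t (deriv_x flux) y s
    = deriv_x (\<lambda>y s. deriv_t \<alpha> y s * deriv_x q y s) y s
    - lam * deriv_x (\<lambda>y s. \<alpha> y s * deriv_x (deriv_x q) y s) y s
    + deriv_x (\<lambda>y s. \<alpha> y s * deriv_x (deriv_x flux) y s) y s + \<beta> * deriv_x flux y s"
proof -
  have 1: "C_k_on 4 U (\<lambda>y s. deriv_t \<alpha> y s * deriv_x q y s)"
    by (rule C_k_on_mult[OF openU C_k_on_mono[OF C_\<alpha>_t] C_k_on_mono[OF C_q_x]]) simp_all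
  have 2: "C_k_on 4 U (\<lambda>y s. \<alpha> y s * deriv_x (deriv_x q) y s)"
    by (rule C_k_on_mult[OF openU C_k_on_mono[OF C_\<alpha>] C_q_xx]) simp_all
  have 3: "C_k_on 3 U (\<lambda>y s. \<alpha> y s * deriv_x (deriv_x flux) y s)"
    by (rule C_k_on_mult[OF openU C_k_on_mono[OF C_\<alpha>] C_flux_xx]) simp_all
  have "deriv_t (deriv_x flux) y s = deriv_x (deriv_t flux) y s"
    by (rule deriv_t_deriv_x_commute[OF openU assms C_k_on_mono[OF C_flux]]) simp
  also have "\<dots> = deriv_x (\<lambda>y s. deriv_t \<alpha> y s * deriv_x q y s - lam * (\<alpha> y s * deriv_x (deriv_x q) y s)
      + \<alpha> y s * deriv_x (deriv_x flux) y s + \<beta> * flux y s) y s"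
    by (rule deriv_x_cong[OF openU flux_deriv_t assms])
  also have "\<dots> = deriv_x (\<lambda>y s. deriv_t \<alpha> y s * deriv_x q y s) y s
    - lam * deriv_x (\<lambda>y s. \<alpha> y s * deriv_x (deriv_x q) y s) y s
    + deriv_x (\<lambda>y s. \<alpha> y s * deriv_x (deriv_x flux) y s) y s + \<beta> * deriv_x flux y s"
    unfolding deriv_x_def[of "\<lambda>y s. deriv_t \<alpha> y s * deriv_x q y s - lam * (\<alpha> y s * deriv_x (deriv_x q) y s)
      + \<alpha> y s * deriv_x (deriv_x flux) y s + \<beta> * flux y s"]
    by (rule DERIV_imp_deriv,
        intro DERIV_add DERIV_diff DERIV_cmult has_deriv_x_numeral[OF 1] has_deriv_x_numeral[OF 2] has_deriv_x_numeral[OF 3] has_deriv_x_numeral[OF C_flux] assms)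
  finally show ?thesis .
qed

text \<open>
  The equation is differentiated in \<open>t\<close>, \<open>\<partial>\<^sub>t\<close> is moved inside \<open>\<partial>\<^sub>x\<close>, and the remaining \<open>q\<^sub>t\<close>, \<open>q\<^sub>x\<^sub>t\<close> and
  \<open>(\<alpha> q\<^sub>x)\<^sub>t\<close> are eliminated. The terms are in the order of \<open>rate2\<close>.
\<close>

lemma evolution_twice:
  assumes "(x, t) \<in> U"
  shows "deriv_t (deriv_t q) x t =
    - lam * \<beta> * deriv_x q x t + lam\<^sup>2 * deriv_x (deriv_x q) x t - lam * deriv_x (deriv_x flux) x t
    + deriv_x (\<lambda>y s. deriv_t \<alpha> y s * deriv_x q y s) x t
    - lam * deriv_x (\<lambda>y s. \<alpha> y s * deriv_x (deriv_x q) y s) x t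
    + deriv_x (\<lambda>y s. \<alpha> y s * deriv_x (deriv_x flux) y s) x t
    + 2 * \<beta> * deriv_x flux x t - lam * \<beta> * deriv_x q x t + \<beta>\<^sup>2 * q x t"
proof -
  have "deriv_t (deriv_t q) x t = deriv_t (\<lambda>y s. - lam * deriv_x q y s + deriv_x flux y s + \<beta> * q y s) x t"
    by (rule deriv_t_cong[OF openU evolution assms])
  also have "\<dots> = - lam * deriv_t (deriv_x q) x t + deriv_t (deriv_x flux) x t + \<beta> * deriv_t q x t"
    unfolding deriv_t_def[of "\<lambda>y s. - lam * deriv_x q y s + deriv_x flux y s + \<beta> * q y s"]
    by (rule DERIV_imp_deriv, intro DERIV_add DERIV_cmult has_deriv_t_numeral[OF C_q_x] has_deriv_t_numeral[OF C_flux_x] has_deriv_t_numeral[OF C_q] assms)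
  finally show ?thesis
    unfolding evolution_deriv_x[OF assms] flux_deriv_x_deriv_t[OF assms] evolution[OF assms]
    by (simp add: algebra_simps power2_eq_square)
qed

section \<open>The truncation error\<close>

text \<open>
  The order \<open>6\<close> of differentiability is used up as follows. The deepest term discretises
  \<open>(\<alpha> (\<alpha> q\<^sub>x)\<^sub>x\<^sub>x)\<^sub>x\<close>, the fourth derivative of \<open>q\<close> being the highest; its outermost
  difference is estimated by a Taylor expansion that needs two further derivatives.
\<close>

lemma scheme1_second_order:
  assumes "(x, t) \<in> U"
  shows "second_order (\<lambda>h k. truncation_error (scheme1 \<alpha> lam \<beta> x t h k) q x t h k)"
proof -
  note ox = openU assms
  have grad: "approx x t 3 (gradient q t) (deriv_x q)"
    by (rule approx_gradient[OF ox]) (use C_q in simp)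
  have wgrad: "approx x t 3 (wide_gradient q t) (deriv_x q)"
    by (rule approx_wide_gradient[OF ox]) (use C_q in simp)
  have lap: "approx x t 2 (wide_laplacian q t) (deriv_x (deriv_x q))"
    by (rule approx_wide_laplacian[OF ox]) (use C_q in simp)
  have div_grad: "approx x t 2 (divergence \<alpha> t (gradient q t)) (deriv_x flux)"
    by (rule approx_divergence[OF ox]) (use C5_\<alpha> C_q_x grad in \<open>simp_all add: numeral_eq_Suc\<close>)
  have slope: "approx x t 1 (diffusion_slope \<alpha> q t) (deriv_x (deriv_x flux))"
    unfolding diffusion_slope_def
    by (rule approx_cdiff[OF ox]) (use C_flux_x div_grad in \<open>simp_all add: numeral_2_eq_2 del: C_k_on.simps\<close>)
  have \<alpha>3: "C_k_on 3 U \<alpha>" and \<alpha>t3: "C_k_on 3 U (deriv_t \<alpha>)" and qx3: "C_k_on 3 U (deriv_x q)"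
    and qxx3: "C_k_on 3 U (deriv_x (deriv_x q))"
    using C_k_on_mono[OF C_\<alpha>] C_k_on_mono[OF C_\<alpha>_t] C_k_on_mono[OF C_q_x] C_k_on_mono[OF C_q_xx] by simp_all
  note regularity = \<alpha>3 \<alpha>t3 qx3 qxx3 C_flux_xx
  have divergences: "approx x t 0 (divergence a t e) (deriv_x (\<lambda>y s. a y s * f y s))"
      "C_k_on (Suc 1) U (deriv_x (\<lambda>y s. a y s * f y s))"
    if "C_k_on 3 U a" "C_k_on 3 U f" "approx x t m e f" "1 \<le> m" for a e f m
  proof -
    show "approx x t 0 (divergence a t e) (deriv_x (\<lambda>y s. a y s * f y s))"
      by (rule approx_divergence[OF ox]) (use that approx_mono[OF that(3,4)] in simp_all)
    show "C_k_on (Suc 1) U (deriv_x (\<lambda>y s. a y s * f y s))"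
      using C_k_on_mult[OF openU that(1,2)] by (simp add: numeral_eq_Suc)
  qed
  note near = approx_bigo_step[OF ox]
  have near_div: "(\<lambda>h. divergence a t e h (x + 0 * h) - deriv_x (\<lambda>y s. a y s * f y s) x t) \<in> O[at_right 0](\<lambda>h. h)"
    if "C_k_on 3 U a" "C_k_on 3 U f" "approx x t m e f" "1 \<le> m" for a e f m
    by (rule near[OF divergences[OF that]])

  define d1 where "d1 h = upwind_gradient q x t h - deriv_x q x t" for h
  define d2 where "d2 h = wide_laplacian q t h (x + -1/2 * h) - deriv_x (deriv_x q) x t" for h
  define d3 where "d3 h = diffusion_slope \<alpha> q t h (x + -1/2 * h) - deriv_x (deriv_x flux) x t" for h
  define d4 where "d4 h = divergence (deriv_t \<alpha>) t (gradient q t) h (x + 0 * h)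
    - deriv_x (\<lambda>y s. deriv_t \<alpha> y s * deriv_x q y s) x t" for h
  define d5 where "d5 h = divergence \<alpha> t (wide_laplacian q t) h (x + 0 * h)
    - deriv_x (\<lambda>y s. \<alpha> y s * deriv_x (deriv_x q) y s) x t" for h
  define d6 where "d6 h = divergence \<alpha> t (diffusion_slope \<alpha> q t) h (x + 0 * h)
    - deriv_x (\<lambda>y s. \<alpha> y s * deriv_x (deriv_x flux) y s) x t" for h
  define d7 where "d7 h = divergence \<alpha> t (gradient q t) h (x + 0 * h) - deriv_x flux x t" for h
  define d8 where "d8 h = wide_gradient q t h (x + 0 * h) - deriv_x q x t" for h

  have d1: "d1 \<in> O[at_right 0](\<lambda>h. h\<^sup>2)"
    unfolding d1_def by (rule upwind_gradient_consistent[OF ox C_k_on_mono[OF C_q]]) simp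
  have d7: "d7 \<in> O[at_right 0](\<lambda>h. h\<^sup>2)"
    unfolding d7_def using approx_at[OF div_grad, of 0] by simp
  have step: "e \<in> O[at_right 0](\<lambda>h. h)" if "e \<in> O[at_right 0](\<lambda>h. h\<^sup>2)" for e :: "real \<Rightarrow> real"
    using landau_o.big_trans[OF that] power_bigo_mono_at_right[of 1 2] by simp
  have "d2 \<in> O[at_right 0](\<lambda>h. h)"
    unfolding d2_def by (rule near[OF lap, of 2]) (use qxx3 in \<open>simp add: numeral_eq_Suc\<close>)
  moreover have "d3 \<in> O[at_right 0](\<lambda>h. h)"
    unfolding d3_def by (rule near[OF slope, of 2]) (use C_flux_xx in \<open>simp add: numeral_eq_Suc\<close>)
  moreover have "d4 \<in> O[at_right 0](\<lambda>h. h)"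
    unfolding d4_def by (rule near_div[OF _ _ grad]) (use regularity in simp_all)
  moreover have "d5 \<in> O[at_right 0](\<lambda>h. h)"
    unfolding d5_def by (rule near_div[OF _ _ lap]) (use regularity in simp_all)
  moreover have "d6 \<in> O[at_right 0](\<lambda>h. h)"
    unfolding d6_def by (rule near_div[OF _ _ slope]) (use regularity in simp_all)
  moreover have "d8 \<in> O[at_right 0](\<lambda>h. h)"
    unfolding d8_def by (rule near[OF wgrad, of 2]) (use qx3 in \<open>simp add: numeral_eq_Suc\<close>)
  ultimately have rate2: "(\<lambda>h. lam * \<beta> * d1 h - lam\<^sup>2 * d2 h + lam * d3 h - d4 h + lam * d5 h - d6 h
      - 2 * \<beta> * d7 h + lam * \<beta> * d8 h) \<in> O[at_right 0](\<lambda>h. h)" (is "?e2 \<in> _")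
    by (intro sum_in_bigo bigo_cmult step[OF d1] step[OF d7])
  have rate2_eq: "deriv_t (deriv_t q) x t - rate2 \<alpha> lam \<beta> q x t h = ?e2 h" for h
    unfolding evolution_twice[OF assms] rate2_def d1_def d2_def d3_def d4_def d5_def d6_def d7_def d8_def
    by (simp add: algebra_simps)

  have rate1: "(\<lambda>h. lam * d1 h - d7 h) \<in> O[at_right 0](\<lambda>h. h\<^sup>2)"
    by (intro sum_in_bigo bigo_cmult d1 d7)
  have rate1_eq: "deriv_t q x t - rate1 \<alpha> lam \<beta> q x t h = lam * d1 h - d7 h" for h
    unfolding evolution[OF assms] rate1_def d1_def d7_def by (simp add: algebra_simps)

  have rate3: "rate3 \<alpha> lam \<beta> q x t \<in> O[at_right 0](\<lambda>_. 1)"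
    unfolding rate3_def
    by (intro sum_in_bigo bigo_cmult bounded_of_bigo_step[OF near_div[OF _ _ grad]]
        bounded_of_bigo_step[OF near_div[OF _ _ lap]] bounded_of_bigo_step[OF near_div[OF _ _ slope]])
       (use regularity in simp_all)

  define r where "r k = (q x (t + k) - (\<Sum>m<3. (deriv_t ^^ m) q x t / fact m * k ^ m)) / (1 * k)" for k
  have r: "r \<in> O[at_right 0](\<lambda>k. k\<^sup>2)"
    unfolding r_def
  proof (rule bigo_divide_factor)
    show "\<forall>\<^sub>F k in at_right 0. k \<noteq> (0 :: real)"
      by (rule eventually_mono[OF eventually_at_right_less]) simp
    show "(\<lambda>k. q x (t + k) - (\<Sum>m<3. (deriv_t ^^ m) q x t / fact m * k ^ m)) \<in> O[at_right 0](\<lambda>k. k ^ Suc 2)"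
      using C_k_on_taylor_t[OF ox C_k_on_mono[OF C_q], of 3] by (simp add: numeral_eq_Suc)
  qed simp

  show ?thesis
  proof (rule second_orderI[OF r rate1 bigo_cmult[OF rate2, of "1/2"] bigo_cmult[OF rate3, of "-1/4"]])
    fix h k :: real
    assume "0 < h" "0 < k"
    then show "truncation_error (scheme1 \<alpha> lam \<beta> x t h k) q x t h k
      = r k + (lam * d1 h - d7 h) + k * (1/2 * ?e2 h) + k\<^sup>2 * (-1/4 * rate3 \<alpha> lam \<beta> q x t h)"
      unfolding rate1_eq[symmetric] rate2_eq[symmetric] truncation_error_def scheme1_expansion[OF \<open>0 < h\<close>] r_def
      by (simp add: numeral_3_eq_3 lessThan_Suc field_simps power2_eq_square)
  qed
qed

end

theorem theorem5:
  shows "\<exists>k. \<forall>lam \<beta> U q x t.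
    lam > 0 \<longrightarrow> open U \<longrightarrow> (x, t) \<in> U \<longrightarrow> C_k_on k U q \<longrightarrow>
      (\<forall>\<alpha>. C_k_on k U \<alpha> \<longrightarrow> solves_adv_diff_reac \<alpha> lam \<beta> U q \<longrightarrow>
         second_order (\<lambda>\<Delta>x \<Delta>t. truncation_error (scheme1 \<alpha> lam \<beta> x t \<Delta>x \<Delta>t) q x t \<Delta>x \<Delta>t)) \<and>
      (\<forall>\<alpha>. solves_adv_diff_reac (\<lambda>_ _. \<alpha>) lam \<beta> U q \<longrightarrow>
         second_order (\<lambda>\<Delta>x \<Delta>t. truncation_error (scheme2 \<alpha> lam \<beta> \<Delta>x \<Delta>t) q x t \<Delta>x \<Delta>t)) \<and>
      (solves_adv_reac lam \<beta> U q \<longrightarrow>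
         second_order (\<lambda>\<Delta>x \<Delta>t. truncation_error (scheme3 lam \<beta> \<Delta>x \<Delta>t) q x t \<Delta>x \<Delta>t))"
proof (rule exI[of _ 6], intro allI impI conjI)
  fix lam \<beta> :: real and U q x t
  assume U: "open U" "(x, t) \<in> U" and q: "C_k_on 6 U q"
  show "second_order (\<lambda>\<Delta>x \<Delta>t. truncation_error (scheme1 \<alpha> lam \<beta> x t \<Delta>x \<Delta>t) q x t \<Delta>x \<Delta>t)"
    if "C_k_on 6 U \<alpha>" "solves_adv_diff_reac \<alpha> lam \<beta> U q" for \<alpha>
    by (rule scheme1_second_order[OF U(1) q that U(2)])
  show const_diffusion: "second_order (\<lambda>\<Delta>x \<Delta>t. truncation_error (scheme2 \<alpha> lam \<beta> \<Delta>x \<Delta>t) q x t \<Delta>x \<Delta>t)"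
    if "solves_adv_diff_reac (\<lambda>_ _. \<alpha>) lam \<beta> U q" for \<alpha>
    unfolding scheme2_eq_scheme1[where x = x and t = t]
    by (rule scheme1_second_order[OF U(1) q C_k_on_const[OF U(1)] that U(2)])
  assume "solves_adv_reac lam \<beta> U q"
  then have "solves_adv_diff_reac (\<lambda>_ _. 0) lam \<beta> U q"
    by (simp add: solves_adv_reac_def solves_adv_diff_reac_def deriv_x_def[of "\<lambda>_ _. 0"])
  then show "second_order (\<lambda>\<Delta>x \<Delta>t. truncation_error (scheme3 lam \<beta> \<Delta>x \<Delta>t) q x t \<Delta>x \<Delta>t)"
    unfolding scheme3_eq_scheme2 by (rule const_diffusion)
qed

end
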